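(* Let $\{\gamma_t: t\in J\}$ be a convex solution to the curve shortening flow in $\mathbb{H}^2$ such that the corresponding pressure function $p=\kappa^2$, expressed in the variables $(t,\varphi)$, can be written as $$p(t,\varphi)=a(t)+b(\varphi)$$ for some functions $a$ and $b$. Then the solution is a family of shrinking circles, a family of horocycles, a family of equidistant lines, or a soliton.
   Context: $\mathbb{H}^2$ is the hyperbolic plane (upper half-plane $\{y>0\}$ with metric $\frac{dx^2+dy^2}{y^2}$). A family $\gamma_t=\gamma(t,\cdot)$, $t\in J$ ($J$ an interval containing the initial time $0$), is a solution of the curve shortening flow (CSF) if $\partial_t\gamma_t=\kappa(t,\cdot)N(t,\cdot)$ (up to tangential reparametrization), where $\kappa(t,\cdot)$ and $N(t,\cdot)$ are the geodesic curvature and unit normal of $\gamma_t$. It is convex if $\kappa>0$, so that the angle $\varphi$ below can be used as a parameter along each curve. The angle parameter $\varphi$ (Grayson): let $\partial/\partial s$ denote the arc-length derivative along $\gamma_t$. On the initial curve, $\varphi(0,u)=\int_0^{s(u)}\kappa\,ds$. The function $\varphi$ and a correction factor $\rho>0$ (with $\rho=1$ at $t=0$) are determined by $\rho\,\frac{\partial\varphi}{\partial s}=\kappa$ and $\rho\,\frac{\partial\varphi}{\partial t}=\frac{\partial\kappa}{\partial s}$. One replaces the time derivative by $\frac{\partial}{\partial\tau}=\frac{\partial}{\partial t}-\frac1\kappa\frac{\partial\kappa}{\partial s}\frac{\partial}{\partial s}$, for which $\frac{\partial\varphi}{\partial\tau}=0$; thus $\tau$ and $\varphi$ are independent variables (time,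 and angle held fixed), and $\tau$ is renamed $t$. The pressure function $p(t,\varphi)$ is $\kappa^2$ as a function of these variables. Circles are hyperbolic circles (constant $\kappa>1$); horocycles have constant curvature $1$; equidistant lines are connected curves of points at fixed positive distance from a geodesic, on one side of it (constant curvature in $(0,1)$). "Family of shrinking circles" (horocycles, equidistant lines) means each $\gamma_t$ is (an arc of) such a curve. A soliton is a solution of the CSF that evolves by a one-parameter group of isometries of $\mathbb{H}^2$ (hyperbolic translations, parabolic translations or rotations). *)

theory Defs
  imports "HOL-Analysis.Analysis"
begin

section \<open>The hyperbolic plane (upper half-plane model)\<close>

definition hyp_plane :: "complex set" where
  "hyp_plane = {z. Im z > 0}"

text \<open>The metric $(dx^2+dy^2)/y^2$ at the point \<open>z\<close>.\<close>

definition hyp_inner :: "complex \<Rightarrow> complex \<Rightarrow> complex \<Rightarrow> real" where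
  "hyp_inner z v w = (v \<bullet> w) / (Im z)\<^sup>2"

definition hyp_norm :: "complex \<Rightarrow> complex \<Rightarrow> real" where
  "hyp_norm z v = sqrt (hyp_inner z v v)"

text \<open>The standard closed formula for the distance induced by \<open>hyp_inner\<close>; only meaningful for
  points of \<open>hyp_plane\<close>.\<close>

definition hyp_dist :: "complex \<Rightarrow> complex \<Rightarrow> real" where
  "hyp_dist z w = arcosh (1 + (cmod (z - w))\<^sup>2 / (2 * Im z * Im w))"

definition hyp_isometry :: "(complex \<Rightarrow> complex) \<Rightarrow> bool" where
  "hyp_isometry f \<longleftrightarrow> bij_betw f hyp_plane hyp_plane \<and>
     (\<forall>z\<in>hyp_plane. \<forall>w\<in>hyp_plane. hyp_dist (f z) (f w) = hyp_dist z w)"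

text \<open>The nontrivial continuous one-parameter groups are exactly those of hyperbolic translations,
  of parabolic translations and of rotations.\<close>

definition one_parameter_isometry_group :: "(real \<Rightarrow> complex \<Rightarrow> complex) \<Rightarrow> bool" where
  "one_parameter_isometry_group \<Phi> \<longleftrightarrow>
     (\<forall>t. hyp_isometry (\<Phi> t)) \<and>
     (\<forall>s t. \<forall>z\<in>hyp_plane. \<Phi> (s + t) z = \<Phi> s (\<Phi> t z)) \<and>
     (\<forall>z\<in>hyp_plane. continuous_on UNIV (\<lambda>t. \<Phi> t z))"

definition hyp_circle :: "complex \<Rightarrow> real \<Rightarrow> complex set" where
  "hyp_circle c r = {w \<in> hyp_plane. hyp_dist c w = r}"

text \<open>Horocycles: Euclidean circles tangent to the real axis (without the point of tangency), and
  horizontal lines (those based at the point at infinity).\<close>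

definition hyp_horocycle :: "complex set \<Rightarrow> bool" where
  "hyp_horocycle H \<longleftrightarrow>
     (\<exists>x r. r > 0 \<and> H = {w \<in> hyp_plane. cmod (w - Complex x r) = r}) \<or>
     (\<exists>h>0. H = {w \<in> hyp_plane. Im w = h})"

text \<open>Complete geodesics: vertical half-lines and half-circles centred on the real axis.\<close>

definition hyp_geodesic :: "complex set \<Rightarrow> bool" where
  "hyp_geodesic G \<longleftrightarrow>
     (\<exists>x. G = {w \<in> hyp_plane. Re w = x}) \<or>
     (\<exists>x r. r > 0 \<and> G = {w \<in> hyp_plane. cmod (w - complex_of_real x) = r})"

definition hyp_infdist :: "complex \<Rightarrow> complex set \<Rightarrow> real" where
  "hyp_infdist w G = (INF z\<in>G. hyp_dist w z)"

text \<open>The two sides of a geodesic \<open>G\<close> are the connected components of its complement.\<close>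

definition hyp_equidistant_line :: "complex set \<Rightarrow> bool" where
  "hyp_equidistant_line E \<longleftrightarrow>
     (\<exists>G S d. hyp_geodesic G \<and> S \<in> components (hyp_plane - G) \<and> d > 0 \<and>
        E = {w \<in> S. hyp_infdist w G = d})"

section \<open>Curves in the hyperbolic plane\<close>

text \<open>A curve is a map \<open>c\<close> on a parameter interval \<open>I\<close>; derivatives are taken within \<open>I\<close>, hence are
  one-sided at end points belonging to \<open>I\<close>. Closed curves are included as periodic maps on
  \<open>I = UNIV\<close>.\<close>

definition curve_speed :: "real set \<Rightarrow> (real \<Rightarrow> complex) \<Rightarrow> real \<Rightarrow> real" where
  "curve_speed I c u = hyp_norm (c u) (vector_derivative c (at u within I))"

definition arc_deriv ::
  "real set \<Rightarrow> (real \<Rightarrow> complex) \<Rightarrow> (real \<Rightarrow> 'a::real_normed_vector) \<Rightarrow> real \<Rightarrow> 'a" where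
  "arc_deriv I c f u = (1 / curve_speed I c u) *\<^sub>R vector_derivative f (at u within I)"

definition unit_tangent :: "real set \<Rightarrow> (real \<Rightarrow> complex) \<Rightarrow> real \<Rightarrow> complex" where
  "unit_tangent I c = arc_deriv I c c"

text \<open>The metric is conformal, so the counterclockwise rotation by a right angle is multiplication
  by \<open>\<i>\<close>.\<close>

definition unit_normal :: "real set \<Rightarrow> (real \<Rightarrow> complex) \<Rightarrow> real \<Rightarrow> complex" where
  "unit_normal I c u = \<i> * unit_tangent I c u"

text \<open>Covariant arc-length derivative of a vector field \<open>V\<close> along \<open>c\<close>. In complex notation the
  Christoffel symbols of the metric combine into $\Gamma_z(v,w) = i v w / \mathrm{Im}\, z$.\<close>

definition cov_arc_deriv ::
  "real set \<Rightarrow> (real \<Rightarrow> complex) \<Rightarrow> (real \<Rightarrow> complex) \<Rightarrow> real \<Rightarrow> complex" where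
  "cov_arc_deriv I c V u =
     arc_deriv I c V u + \<i> * unit_tangent I c u * V u / complex_of_real (Im (c u))"

definition geodesic_curvature :: "real set \<Rightarrow> (real \<Rightarrow> complex) \<Rightarrow> real \<Rightarrow> real" where
  "geodesic_curvature I c u =
     hyp_inner (c u) (cov_arc_deriv I c (unit_tangent I c) u) (unit_normal I c u)"

section \<open>Curve shortening flow\<close>

text \<open>\<open>D m n\<close> is the mixed partial derivative of order \<open>m\<close> in \<open>t\<close> and \<open>n\<close> in \<open>u\<close>.\<close>

definition smooth_family ::
  "real set \<Rightarrow> real set \<Rightarrow> (real \<Rightarrow> real \<Rightarrow> 'a::real_normed_vector) \<Rightarrow> bool" where
  "smooth_family J I f \<longleftrightarrow>
     (\<exists>D :: nat \<Rightarrow> nat \<Rightarrow> real \<Rightarrow> real \<Rightarrow> 'a. D 0 0 = f \<and>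
        (\<forall>m n. continuous_on (J \<times> I) (\<lambda>(t, u). D m n t u) \<and>
           (\<forall>t\<in>J. \<forall>u\<in>I.
              ((\<lambda>t'. D m n t' u) has_vector_derivative D (Suc m) n t u) (at t within J) \<and>
              ((\<lambda>u'. D m n t u') has_vector_derivative D m (Suc n) t u) (at u within I))))"

text \<open>The tangential part of the velocity is left free (solutions up to tangential
  reparametrization): only its normal component is prescribed.\<close>

definition csf_solution ::
  "real set \<Rightarrow> real set \<Rightarrow> (real \<Rightarrow> real \<Rightarrow> complex) \<Rightarrow> bool" where
  "csf_solution J I \<gamma> \<longleftrightarrow>
     smooth_family J I \<gamma> \<and>
     (\<forall>t\<in>J. \<forall>u\<in>I.
        \<gamma> t u \<in> hyp_plane \<and>
        vector_derivative (\<gamma> t) (at u within I) \<noteq> 0 \<and>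
        hyp_inner (\<gamma> t u) (vector_derivative (\<lambda>t'. \<gamma> t' u) (at t within J))
          (unit_normal I (\<gamma> t) u) = geodesic_curvature I (\<gamma> t) u)"

definition convex_family ::
  "real set \<Rightarrow> real set \<Rightarrow> (real \<Rightarrow> real \<Rightarrow> complex) \<Rightarrow> bool" where
  "convex_family J I \<gamma> \<longleftrightarrow> (\<forall>t\<in>J. \<forall>u\<in>I. geodesic_curvature I (\<gamma> t) u > 0)"

text \<open>The time derivative along the purely normal motion $\partial_t\gamma = \kappa N$: the
  contribution of the tangential velocity of the given parametrization is subtracted. It is the plain
  partial derivative in \<open>t\<close> if $\partial_t\gamma = \kappa N$ holds literally.\<close>

definition normal_time_deriv ::
  "real set \<Rightarrow> real set \<Rightarrow> (real \<Rightarrow> real \<Rightarrow> complex) \<Rightarrow> (real \<Rightarrow> real \<Rightarrow> real) \<Rightarrow>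
   real \<Rightarrow> real \<Rightarrow> real" where
  "normal_time_deriv J I \<gamma> f t u =
     vector_derivative (\<lambda>t'. f t' u) (at t within J) -
     hyp_inner (\<gamma> t u) (vector_derivative (\<lambda>t'. \<gamma> t' u) (at t within J))
       (unit_tangent I (\<gamma> t) u) * arc_deriv I (\<gamma> t) (f t) u"

text \<open>Grayson's angle \<open>\<phi>\<close> with correction factor \<open>\<rho>\<close>; the arc length on the initial curve is measured
  from the parameter \<open>u0\<close>, and $\int_0^{s(u)}\kappa\,ds$ is written as a (signed) integral over the
  parameter, with $ds$ the speed times $dv$.\<close>

definition grayson_angle ::
  "real set \<Rightarrow> real set \<Rightarrow> (real \<Rightarrow> real \<Rightarrow> complex) \<Rightarrow> real \<Rightarrow>
   (real \<Rightarrow> real \<Rightarrow> real) \<Rightarrow> (real \<Rightarrow> real \<Rightarrow> real) \<Rightarrow> bool" where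
  "grayson_angle J I \<gamma> u0 \<phi> \<rho> \<longleftrightarrow>
     smooth_family J I \<phi> \<and> smooth_family J I \<rho> \<and>
     (\<forall>u\<in>I. \<rho> 0 u = 1 \<and>
        \<phi> 0 u = (LBINT v=ereal u0..ereal u.
                   geodesic_curvature I (\<gamma> 0) v * curve_speed I (\<gamma> 0) v)) \<and>
     (\<forall>t\<in>J. \<forall>u\<in>I.
        \<rho> t u > 0 \<and>
        \<rho> t u * arc_deriv I (\<gamma> t) (\<phi> t) u = geodesic_curvature I (\<gamma> t) u \<and>
        \<rho> t u * normal_time_deriv J I \<gamma> \<phi> t u =
          arc_deriv I (\<gamma> t) (geodesic_curvature I (\<gamma> t)) u)"

text \<open>The squared curvature as a function of time and angle, defined for \<open>x \<in> \<phi> t ` I\<close>. For a convex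
  solution \<open>\<phi> t\<close> is strictly increasing on \<open>I\<close>, hence can be inverted.\<close>

definition pressure ::
  "real set \<Rightarrow> (real \<Rightarrow> real \<Rightarrow> complex) \<Rightarrow> (real \<Rightarrow> real \<Rightarrow> real) \<Rightarrow> real \<Rightarrow> real \<Rightarrow> real" where
  "pressure I \<gamma> \<phi> t x = (geodesic_curvature I (\<gamma> t) (the_inv_into I (\<phi> t) x))\<^sup>2"

section \<open>Special families\<close>

text \<open>An immersed curve whose image lies in a circle, horocycle or equidistant line runs along an
  arc of it (possibly all of it).\<close>

definition shrinking_circles ::
  "real set \<Rightarrow> real set \<Rightarrow> (real \<Rightarrow> real \<Rightarrow> complex) \<Rightarrow> bool" where
  "shrinking_circles J I \<gamma> \<longleftrightarrow>
     (\<exists>c r. strict_antimono_on J r \<and>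
        (\<forall>t\<in>J. c t \<in> hyp_plane \<and> r t > 0 \<and> \<gamma> t ` I \<subseteq> hyp_circle (c t) (r t)))"

definition horocycle_family ::
  "real set \<Rightarrow> real set \<Rightarrow> (real \<Rightarrow> real \<Rightarrow> complex) \<Rightarrow> bool" where
  "horocycle_family J I \<gamma> \<longleftrightarrow> (\<forall>t\<in>J. \<exists>H. hyp_horocycle H \<and> \<gamma> t ` I \<subseteq> H)"

definition equidistant_family ::
  "real set \<Rightarrow> real set \<Rightarrow> (real \<Rightarrow> real \<Rightarrow> complex) \<Rightarrow> bool" where
  "equidistant_family J I \<gamma> \<longleftrightarrow> (\<forall>t\<in>J. \<exists>E. hyp_equidistant_line E \<and> \<gamma> t ` I \<subseteq> E)"

text \<open>\<open>\<theta> t\<close> is the reparametrization; being continuous and bijective on an interval, it is a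
  homeomorphism of \<open>I\<close>.\<close>

definition csf_soliton ::
  "real set \<Rightarrow> real set \<Rightarrow> (real \<Rightarrow> real \<Rightarrow> complex) \<Rightarrow> bool" where
  "csf_soliton J I \<gamma> \<longleftrightarrow> csf_solution J I \<gamma> \<and>
     (\<exists>\<Phi> \<theta>. one_parameter_isometry_group \<Phi> \<and>
        continuous_on (J \<times> I) (\<lambda>(t, u). \<theta> t u) \<and>
        (\<forall>t\<in>J. bij_betw (\<theta> t) I I \<and> (\<forall>u\<in>I. \<gamma> t u = \<Phi> t (\<gamma> 0 (\<theta> t u)))))"

end

theory Submission
  imports Defs
begin

text \<open>
  The geodesic curvature of a solution with separated pressure is constant along each curve, and
  curves of constant curvature are arcs of circles, horocycles and equidistant lines.

  Let \<open>s\<close> be arc length, \<open>v\<close> the speed, \<open>w\<close> the tangential velocity and \<open>\<kappa>\<close> the curvature.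
  Equality of mixed derivatives gives the evolution equations of \<open>v\<close> and \<open>\<kappa>\<close>
  (\<open>curvature_evolution\<close>), in particular \<open>\<kappa>\<^sub>t = \<kappa>\<^sub>s\<^sub>s + w \<kappa>\<^sub>s + \<kappa>\<^sup>3 - \<kappa>\<close>.  They say that the
  vector fields \<open>\<partial>\<close>, the derivative in the angle at a fixed time, and \<open>L\<close>, the time derivative at a
  fixed angle, commute; both are explicit in terms of \<open>v\<close>, \<open>w\<close> and \<open>\<kappa>\<close>, with the correction factor
  \<open>exp (- t)\<close>.  The pressure \<open>p = \<kappa>\<^sup>2\<close> satisfies
  \<open>L p = exp (2t) (p \<partial>\<partial>p - (\<partial>p)\<^sup>2 / 2) + 2 p\<^sup>2 - 2 p\<close>.

  If \<open>p = a + b\<close>, then \<open>L p\<close> depends on time only (\<open>separated_level_derivative\<close>), and \<open>L\<close> annihilates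
  every \<open>\<partial>\<close>-derivative of \<open>p\<close>.  Differentiating the pressure equation first by \<open>\<partial>\<close> and then by \<open>L\<close>
  gives two linear relations between \<open>\<partial>p\<close> and \<open>\<partial>\<partial>\<partial>p\<close>, which are compatible only if \<open>\<partial>p = 0\<close>
  (\<open>separated_pressure_constant\<close>).  The curvature of the ambient plane, which produces the factor
  \<open>exp (2t)\<close> and the term \<open>- 2 p\<close>, is what makes these relations independent.

  The curvature is therefore a function \<open>K\<close> of time with \<open>K' = K\<^sup>3 - K\<close>, whence
  \<open>1 - 1 / K\<^sup>2 = c exp (2t)\<close> with a constant \<open>c\<close> (\<open>curvature_time_law\<close>).  The sign of \<open>c\<close> decides
  whether \<open>K\<close> stays above, at or below \<open>1\<close>, and so whether the curves are circles, horocycles or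
  equidistant lines (\<open>constant_curvature_locus\<close>).  For circles \<open>K\<close> increases and the radius, whose
  hyperbolic cotangent is \<open>K\<close>, decreases.
\<close>

section \<open>Smooth functions on an open rectangle\<close>

text \<open>Stating differentiability through some pair of partial derivatives, instead of through the
  operators below, makes invariance under pointwise equality and all closure properties plain
  inductions.\<close>

primrec ck_on :: "nat \<Rightarrow> real set \<Rightarrow> real set \<Rightarrow> (real \<Rightarrow> real \<Rightarrow> real) \<Rightarrow> bool" where
  "ck_on 0 A B f \<longleftrightarrow> continuous_on (A \<times> B) (\<lambda>(t, u). f t u)"
| "ck_on (Suc k) A B f \<longleftrightarrow> continuous_on (A \<times> B) (\<lambda>(t, u). f t u) \<and>
     (\<exists>ft fu. (\<forall>t\<in>A. \<forall>u\<in>B. ((\<lambda>t'. f t' u) has_real_derivative ft t u) (at t) \<and>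
                (f t has_real_derivative fu t u) (at u)) \<and>
        ck_on k A B ft \<and> ck_on k A B fu)"

definition smooth :: "real set \<Rightarrow> real set \<Rightarrow> (real \<Rightarrow> real \<Rightarrow> real) \<Rightarrow> bool" where
  "smooth A B f \<longleftrightarrow> (\<forall>k. ck_on k A B f)"

definition dt :: "(real \<Rightarrow> real \<Rightarrow> real) \<Rightarrow> real \<Rightarrow> real \<Rightarrow> real" where
  "dt f t u = deriv (\<lambda>t'. f t' u) t"

definition du :: "(real \<Rightarrow> real \<Rightarrow> real) \<Rightarrow> real \<Rightarrow> real \<Rightarrow> real" where
  "du f t u = deriv (f t) u"

lemma ck_on_imp_continuous: "ck_on k A B f \<Longrightarrow> continuous_on (A \<times> B) (\<lambda>(t, u). f t u)"
  by (cases k) auto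

lemma ck_on_Suc_imp: "ck_on (Suc k) A B f \<Longrightarrow> ck_on k A B f"
proof (induction k arbitrary: f)
  case (Suc k)
  from Suc.prems obtain ft fu where
    "\<forall>t\<in>A. \<forall>u\<in>B. ((\<lambda>t'. f t' u) has_real_derivative ft t u) (at t) \<and>
                (f t has_real_derivative fu t u) (at u)"
    "ck_on (Suc k) A B ft" "ck_on (Suc k) A B fu" "continuous_on (A \<times> B) (\<lambda>(t, u). f t u)"
    by (simp only: ck_on.simps) blast
  moreover from this Suc.IH have "ck_on k A B ft" "ck_on k A B fu" by blast+
  ultimately show ?case by (simp only: ck_on.simps) blast
qed simp

lemma ck_onI:
  assumes "continuous_on (A \<times> B) (\<lambda>(t, u). f t u)"
    and "\<And>t u. t \<in> A \<Longrightarrow> u \<in> B \<Longrightarrow> ((\<lambda>t'. f t' u) has_real_derivative ft t u) (at t)"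
    and "\<And>t u. t \<in> A \<Longrightarrow> u \<in> B \<Longrightarrow> (f t has_real_derivative fu t u) (at u)"
    and "ck_on k A B ft" and "ck_on k A B fu"
  shows "ck_on (Suc k) A B f"
  using assms by (simp only: ck_on.simps) blast

lemma ck_onE:
  assumes "ck_on (Suc k) A B f"
  obtains ft fu where "\<And>t u. t \<in> A \<Longrightarrow> u \<in> B \<Longrightarrow> ((\<lambda>t'. f t' u) has_real_derivative ft t u) (at t)"
    and "\<And>t u. t \<in> A \<Longrightarrow> u \<in> B \<Longrightarrow> (f t has_real_derivative fu t u) (at u)"
    and "ck_on k A B ft" and "ck_on k A B fu"
  using assms by (simp only: ck_on.simps) blast

lemma ck_on_cong:
  assumes "open A" "open B" and eq: "\<And>t u. t \<in> A \<Longrightarrow> u \<in> B \<Longrightarrow> f t u = g t u"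
    and f: "ck_on k A B f"
  shows "ck_on k A B g"
proof -
  have cont: "continuous_on (A \<times> B) (\<lambda>(t, u). g t u)"
    using ck_on_imp_continuous[OF f] by (rule continuous_on_eq) (use eq in auto)
  show ?thesis
  proof (cases k)
    case 0 then show ?thesis using cont by simp
  next
    case (Suc k')
    obtain ft fu where
      d: "\<And>t u. t \<in> A \<Longrightarrow> u \<in> B \<Longrightarrow> ((\<lambda>t'. f t' u) has_real_derivative ft t u) (at t)"
      "\<And>t u. t \<in> A \<Longrightarrow> u \<in> B \<Longrightarrow> (f t has_real_derivative fu t u) (at u)"
      and ck: "ck_on k' A B ft" "ck_on k' A B fu"
      using f unfolding Suc by (rule ck_onE) blast
    have "((\<lambda>t'. g t' u) has_real_derivative ft t u) (at t)" if "t \<in> A" "u \<in> B" for t u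
      by (rule has_field_derivative_transform_within_open[OF d(1)[OF that] \<open>open A\<close> that(1)])
        (use eq that in auto)
    moreover have "(g t has_real_derivative fu t u) (at u)" if "t \<in> A" "u \<in> B" for t u
      by (rule has_field_derivative_transform_within_open[OF d(2)[OF that] \<open>open B\<close> that(2)])
        (use eq that in auto)
    ultimately show ?thesis unfolding Suc by (intro ck_onI[OF cont _ _ ck])
  qed
qed

lemma continuous_on_rect:
  "continuous_on (A \<times> B) (\<lambda>(t, u). f t u) \<longleftrightarrow> continuous_on (A \<times> B) (\<lambda>z. f (fst z) (snd z))"
  by (simp add: split_beta)

lemma ck_on_const: "ck_on k A B (\<lambda>t u. c)"
  by (induction k arbitrary: c) (auto intro!: ck_onI[where ft="\<lambda>_ _. 0" and fu="\<lambda>_ _. 0"]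
      simp del: ck_on.simps(2))

lemma ck_on_exp: "ck_on k A B (\<lambda>t u. exp (c * t))"
proof -
  have "ck_on k A B (\<lambda>t u. d * exp (c * t))" for d
  proof (induction k arbitrary: d)
    case 0 then show ?case by (auto simp: continuous_on_rect intro!: continuous_intros)
  next
    case (Suc k)
    show ?case
      by (rule ck_onI[OF _ _ _ Suc[of "d * c"] ck_on_const[where c=0]])
        (auto simp: continuous_on_rect intro!: continuous_intros derivative_eq_intros)
  qed
  from this[of 1] show ?thesis by simp
qed

lemma ck_on_add: "ck_on k A B f \<Longrightarrow> ck_on k A B g \<Longrightarrow> ck_on k A B (\<lambda>t u. f t u + g t u)"
proof (induction k arbitrary: f g)
  case 0 then show ?case by (auto simp: continuous_on_rect intro!: continuous_intros)
next
  case (Suc k)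
  note cont = Suc.prems[THEN ck_on_imp_continuous]
  from Suc.prems(1) obtain ft fu where
      f: "\<And>t u. t \<in> A \<Longrightarrow> u \<in> B \<Longrightarrow> ((\<lambda>t'. f t' u) has_real_derivative ft t u) (at t)"
      "\<And>t u. t \<in> A \<Longrightarrow> u \<in> B \<Longrightarrow> (f t has_real_derivative fu t u) (at u)"
      "ck_on k A B ft" "ck_on k A B fu" by (rule ck_onE) blast
  from Suc.prems(2) obtain gt gu where
      g: "\<And>t u. t \<in> A \<Longrightarrow> u \<in> B \<Longrightarrow> ((\<lambda>t'. g t' u) has_real_derivative gt t u) (at t)"
      "\<And>t u. t \<in> A \<Longrightarrow> u \<in> B \<Longrightarrow> (g t has_real_derivative gu t u) (at u)"
      "ck_on k A B gt" "ck_on k A B gu" by (rule ck_onE) blast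
  show ?case
  proof (rule ck_onI[OF _ _ _ Suc.IH[OF f(3) g(3)] Suc.IH[OF f(4) g(4)]])
    show "continuous_on (A \<times> B) (\<lambda>(t, u). f t u + g t u)"
      using cont by (auto simp: continuous_on_rect intro!: continuous_intros)
  qed (auto intro!: derivative_eq_intros f g)
qed

lemma ck_on_mult: "ck_on k A B f \<Longrightarrow> ck_on k A B g \<Longrightarrow> ck_on k A B (\<lambda>t u. f t u * g t u)"
proof (induction k arbitrary: f g)
  case 0 then show ?case by (auto simp: continuous_on_rect intro!: continuous_intros)
next
  case (Suc k)
  note cont = Suc.prems[THEN ck_on_imp_continuous]
  note low = Suc.prems[THEN ck_on_Suc_imp]
  from Suc.prems(1) obtain ft fu where
      f: "\<And>t u. t \<in> A \<Longrightarrow> u \<in> B \<Longrightarrow> ((\<lambda>t'. f t' u) has_real_derivative ft t u) (at t)"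
      "\<And>t u. t \<in> A \<Longrightarrow> u \<in> B \<Longrightarrow> (f t has_real_derivative fu t u) (at u)"
      "ck_on k A B ft" "ck_on k A B fu" by (rule ck_onE) blast
  from Suc.prems(2) obtain gt gu where
      g: "\<And>t u. t \<in> A \<Longrightarrow> u \<in> B \<Longrightarrow> ((\<lambda>t'. g t' u) has_real_derivative gt t u) (at t)"
      "\<And>t u. t \<in> A \<Longrightarrow> u \<in> B \<Longrightarrow> (g t has_real_derivative gu t u) (at u)"
      "ck_on k A B gt" "ck_on k A B gu" by (rule ck_onE) blast
  show ?case
  proof (rule ck_onI[OF _ _ _ ck_on_add[OF Suc.IH[OF f(3) low(2)] Suc.IH[OF low(1) g(3)]]
        ck_on_add[OF Suc.IH[OF f(4) low(2)] Suc.IH[OF low(1) g(4)]]])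
    show "continuous_on (A \<times> B) (\<lambda>(t, u). f t u * g t u)"
      using cont by (auto simp: continuous_on_rect intro!: continuous_intros)
  qed (auto intro!: derivative_eq_intros f g)
qed

lemma ck_on_powr:
  assumes pos: "\<And>t u. t \<in> A \<Longrightarrow> u \<in> B \<Longrightarrow> f t u > 0"
  shows "ck_on k A B f \<Longrightarrow> ck_on k A B (\<lambda>t u. f t u powr a)"
proof (induction k arbitrary: a)
  case 0 then show ?case using pos
    by (auto simp: continuous_on_rect intro!: continuous_intros) (metis less_irrefl)
next
  case (Suc k)
  note low = Suc.prems[THEN ck_on_Suc_imp]
  have cont: "continuous_on (A \<times> B) (\<lambda>(t, u). f t u powr a)"
    using ck_on_imp_continuous[OF Suc.prems] pos
    by (auto simp: continuous_on_rect intro!: continuous_intros) (metis less_irrefl)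
  from Suc.prems(1) obtain ft fu where
      f: "\<And>t u. t \<in> A \<Longrightarrow> u \<in> B \<Longrightarrow> ((\<lambda>t'. f t' u) has_real_derivative ft t u) (at t)"
      "\<And>t u. t \<in> A \<Longrightarrow> u \<in> B \<Longrightarrow> (f t has_real_derivative fu t u) (at u)"
      "ck_on k A B ft" "ck_on k A B fu" by (rule ck_onE) blast
  have g: "ck_on k A B (\<lambda>t u. a * f t u powr (a - 1))"
    by (intro ck_on_mult ck_on_const Suc.IH low)
  show ?case
    by (rule ck_onI[OF cont _ _ ck_on_mult[OF g f(3)] ck_on_mult[OF g f(4)]])
      (use pos in \<open>auto intro!: derivative_eq_intros f has_real_derivative_powr\<close>)
qed

lemma smooth_const [simp]: "smooth A B (\<lambda>t u. c)"
  by (simp add: smooth_def ck_on_const)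

lemma smooth_exp: "smooth A B (\<lambda>t u. exp (c * t))"
  by (simp add: smooth_def ck_on_exp)

lemma smooth_add: "smooth A B f \<Longrightarrow> smooth A B g \<Longrightarrow> smooth A B (\<lambda>t u. f t u + g t u)"
  by (simp add: smooth_def ck_on_add)

lemma smooth_mult: "smooth A B f \<Longrightarrow> smooth A B g \<Longrightarrow> smooth A B (\<lambda>t u. f t u * g t u)"
  by (simp add: smooth_def ck_on_mult)

lemma smooth_diff: "smooth A B f \<Longrightarrow> smooth A B g \<Longrightarrow> smooth A B (\<lambda>t u. f t u - g t u)"
  using smooth_add[of A B f "\<lambda>t u. -1 * g t u"] smooth_mult[of A B "\<lambda>_ _. -1" g] by simp

lemma smooth_power: "smooth A B f \<Longrightarrow> smooth A B (\<lambda>t u. f t u ^ n)"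
  by (induction n) (auto intro: smooth_mult)

lemma smooth_powr:
  "smooth A B f \<Longrightarrow> (\<And>t u. t \<in> A \<Longrightarrow> u \<in> B \<Longrightarrow> f t u > 0) \<Longrightarrow> smooth A B (\<lambda>t u. f t u powr a)"
  by (simp add: smooth_def ck_on_powr)

lemma smooth_cong:
  assumes "open A" "open B" "\<And>t u. t \<in> A \<Longrightarrow> u \<in> B \<Longrightarrow> f t u = g t u" "smooth A B f"
  shows "smooth A B g"
  using assms ck_on_cong unfolding smooth_def by blast

lemma smooth_divide:
  assumes "open A" "open B" "smooth A B f" "smooth A B g"
    and "\<And>t u. t \<in> A \<Longrightarrow> u \<in> B \<Longrightarrow> g t u > 0"
  shows "smooth A B (\<lambda>t u. f t u / g t u)"
proof (rule smooth_cong[OF assms(1,2) _ smooth_mult[OF assms(3) smooth_powr[OF assms(4,5), of "-1"]]])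
  fix t u assume "t \<in> A" "u \<in> B"
  then have "g t u > 0" by (rule assms(5))
  then show "f t u * g t u powr -1 = f t u / g t u"
    by (simp add: powr_minus divide_inverse)
qed auto

lemma smooth_sqrt:
  assumes "open A" "open B" "smooth A B f" "\<And>t u. t \<in> A \<Longrightarrow> u \<in> B \<Longrightarrow> f t u > 0"
  shows "smooth A B (\<lambda>t u. sqrt (f t u))"
  by (rule smooth_cong[OF assms(1,2) _ smooth_powr[OF assms(3,4), of "1/2"]])
    (use assms(4) in \<open>auto simp: powr_half_sqrt less_imp_le\<close>)

lemma smooth_imp_continuous: "smooth A B f \<Longrightarrow> continuous_on (A \<times> B) (\<lambda>(t, u). f t u)"
  using ck_on.simps(1) unfolding smooth_def by blast

lemma smooth_has_dt:
  assumes "smooth A B f" "t \<in> A" "u \<in> B"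
  shows "((\<lambda>t'. f t' u) has_real_derivative dt f t u) (at t)"
proof -
  have "ck_on (Suc 0) A B f" using assms by (simp only: smooth_def)
  then show ?thesis using assms unfolding dt_def
    by (metis (no_types, lifting) DERIV_imp_deriv ck_onE)
qed

lemma smooth_has_du:
  assumes "smooth A B f" "t \<in> A" "u \<in> B"
  shows "(f t has_real_derivative du f t u) (at u)"
proof -
  have "ck_on (Suc 0) A B f" using assms by (simp only: smooth_def)
  then show ?thesis using assms unfolding du_def
    by (metis (no_types, lifting) DERIV_imp_deriv ck_onE)
qed

lemma dt_eqI: "((\<lambda>t'. f t' u) has_real_derivative d) (at t) \<Longrightarrow> dt f t u = d"
  unfolding dt_def by (rule DERIV_imp_deriv)

lemma du_eqI: "(f t has_real_derivative d) (at u) \<Longrightarrow> du f t u = d"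
  unfolding du_def by (rule DERIV_imp_deriv)

lemma smooth_dt:
  assumes "open A" "open B" "smooth A B f"
  shows "smooth A B (dt f)"
  unfolding smooth_def
proof
  fix k
  have "ck_on (Suc k) A B f" using assms by (simp only: smooth_def)
  then obtain ft fu where
      f: "\<And>t u. t \<in> A \<Longrightarrow> u \<in> B \<Longrightarrow> ((\<lambda>t'. f t' u) has_real_derivative ft t u) (at t)"
      "ck_on k A B ft" by (rule ck_onE) blast
  show "ck_on k A B (dt f)"
    by (rule ck_on_cong[OF assms(1,2) _ f(2)]) (simp add: dt_eqI[OF f(1)])
qed

lemma smooth_du:
  assumes "open A" "open B" "smooth A B f"
  shows "smooth A B (du f)"
  unfolding smooth_def
proof
  fix k
  have "ck_on (Suc k) A B f" using assms by (simp only: smooth_def)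
  then obtain ft fu where
      f: "\<And>t u. t \<in> A \<Longrightarrow> u \<in> B \<Longrightarrow> (f t has_real_derivative fu t u) (at u)"
      "ck_on k A B fu" by (rule ck_onE) blast
  show "ck_on k A B (du f)"
    by (rule ck_on_cong[OF assms(1,2) _ f(2)]) (simp add: du_eqI[OF f(1)])
qed

lemma dt_cong:
  assumes "open A" "t \<in> A" "\<And>t'. t' \<in> A \<Longrightarrow> f t' u = g t' u"
  shows "dt f t u = dt g t u"
  unfolding dt_def by (rule deriv_cong_ev)
    (use assms in \<open>auto intro!: eventually_nhds_in_open[THEN eventually_mono]\<close>)

lemma du_cong:
  assumes "open B" "u \<in> B" "\<And>u'. u' \<in> B \<Longrightarrow> f t u' = g t u'"
  shows "du f t u = du g t u"
  unfolding du_def by (rule deriv_cong_ev)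
    (use assms in \<open>auto intro!: eventually_nhds_in_open[THEN eventually_mono]\<close>)

text \<open>Symmetry of second derivatives: write \<open>f\<close> as the integral of its \<open>u\<close>-derivative, differentiate
  under the integral sign in \<open>t\<close>, and then differentiate the integral in its upper limit.\<close>

lemma du_dt_commute:
  assumes AB: "open A" "open B" and f: "smooth A B f" and tu: "t \<in> A" "u \<in> B"
  shows "du (dt f) t u = dt (du f) t u"
proof -
  obtain e where e: "e > 0" "cball u e \<subseteq> B" using AB(2) tu(2) open_contains_cball by blast
  obtain d where d: "d > 0" "ball t d \<subseteq> A" using AB(1) tu(1) open_contains_ball by blast
  define l r where "l = u - e" and "r = u + e"
  have lr: "{l..r} \<subseteq> B" using e(2) by (simp add: l_def r_def cball_eq_atLeastAtMost)
  have lu: "l < u" "u < r" using e by (auto simp: l_def r_def)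
  note du = smooth_du[OF AB f]
  have dint: "((\<lambda>s. integral {l..y} (du f s)) has_real_derivative integral {l..y} (dt (du f) t)) (at t)"
    if y: "y \<in> {l..r}" for y
  proof -
    have "((\<lambda>s. integral (cbox l y) (du f s)) has_vector_derivative integral (cbox l y) (dt (du f) t))
      (at t within ball t d)"
    proof (rule leibniz_rule_vector_derivative)
      fix s x assume s: "s \<in> ball t d" and x: "x \<in> cbox l y"
      then have "s \<in> A" "x \<in> B" using d lr y by auto
      then show "((\<lambda>s. du f s x) has_vector_derivative dt (du f) s x) (at s within ball t d)"
        using smooth_has_dt[OF du] has_field_derivative_at_within
        unfolding has_real_derivative_iff_has_vector_derivative[symmetric] by blast
    next
      fix s assume s: "s \<in> ball t d"
      have "continuous_on (cbox l y) (du f s)"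
        by (rule continuous_on_compose2[OF smooth_imp_continuous[OF du, unfolded continuous_on_rect],
              of _ "\<lambda>x. (s, x)", simplified]) (use s d lr y in \<open>auto intro!: continuous_intros\<close>)
      then show "du f s integrable_on cbox l y" by (rule integrable_continuous)
    next
      show "continuous_on (ball t d \<times> cbox l y) (\<lambda>(x, t). dt (du f) x t)"
        by (rule continuous_on_subset[OF smooth_imp_continuous[OF smooth_dt[OF AB du]]])
          (use d lr y in auto)
    qed (use d in auto)
    moreover have "at t within ball t d = at t"
      using d by (intro at_within_open) auto
    ultimately show ?thesis
      by (simp add: has_real_derivative_iff_has_vector_derivative)
  qed
  have ftc: "integral {l..y} (du f s) = f s y - f s l" if "s \<in> A" "y \<in> {l..r}" for s y
  proof (rule integral_unique, rule fundamental_theorem_of_calculus)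
    fix x assume "x \<in> {l..y}"
    then have "x \<in> B" using that lr by auto
    then show "(f s has_vector_derivative du f s x) (at x within {l..y})"
      using smooth_has_du[OF f \<open>s \<in> A\<close>]
      by (simp add: has_real_derivative_iff_has_vector_derivative has_vector_derivative_at_within)
  qed (use that in auto)
  have dtf: "dt f t y = dt f t l + integral {l..y} (dt (du f) t)" if y: "y \<in> {l..r}" for y
  proof -
    have "((\<lambda>s. f s y - f s l) has_real_derivative integral {l..y} (dt (du f) t)) (at t)"
      by (rule has_field_derivative_transform_within_open[OF dint[OF y] AB(1) tu(1)])
        (rule ftc[OF _ y])
    moreover have "((\<lambda>s. f s y - f s l) has_real_derivative dt f t y - dt f t l) (at t)"
      by (rule DERIV_diff; rule smooth_has_dt[OF f]) (use tu lr y lu in auto)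
    ultimately show ?thesis using DERIV_unique by fastforce
  qed
  have "continuous_on {l..r} (dt (du f) t)"
    by (rule continuous_on_compose2[OF smooth_imp_continuous[OF smooth_dt[OF AB du], unfolded continuous_on_rect],
          of _ "\<lambda>x. (t, x)", simplified]) (use tu lr in \<open>auto intro!: continuous_intros\<close>)
  then have "((\<lambda>y. integral {l..y} (dt (du f) t)) has_real_derivative dt (du f) t u) (at u within {l..r})"
    by (rule integral_has_real_derivative) (use lu in auto)
  moreover have "at u within {l..r} = at u"
    using lu by (intro at_within_interior) (simp add: interior_atLeastAtMost_real)
  ultimately have "((\<lambda>y. dt f t l + integral {l..y} (dt (du f) t)) has_real_derivative dt (du f) t u) (at u)"
    by (auto intro!: derivative_eq_intros)
  then have "(dt f t has_real_derivative dt (du f) t u) (at u)"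
    by (rule has_field_derivative_transform_within_open[of _ _ _ "{l<..<r}"])
      (use lu in \<open>auto simp: dtf[symmetric]\<close>)
  then show ?thesis by (rule du_eqI)
qed

section \<open>Rigidity of the pressure equation\<close>

lemma dt_zero:
  assumes "open A" "t \<in> A" "\<And>t'. t' \<in> A \<Longrightarrow> f t' u = 0"
  shows "dt f t u = 0"
  using dt_cong[of A t f u "\<lambda>_ _. 0"] assms by (simp add: dt_def)

lemma du_zero:
  assumes "open B" "u \<in> B" "\<And>u'. u' \<in> B \<Longrightarrow> f t u' = 0"
  shows "du f t u = 0"
  using du_cong[of B u f t "\<lambda>_ _. 0"] assms by (simp add: du_def)

text \<open>The operators \<open>\<partial>\<^sub>t - h \<partial>\<^sub>u\<close> and \<open>g \<partial>\<^sub>u\<close> commute, so they play the role of the two coordinate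
  derivatives of a chart.  Below they are the derivative in time at a fixed angle and the derivative
  in the angle at a fixed time; \<open>gh\<close> is then the closedness of the differential of the angle.\<close>

locale commuting_frame =
  fixes A B :: "real set" and g h :: "real \<Rightarrow> real \<Rightarrow> real"
  assumes open_A: "open A" and open_B: "open B"
    and smooth_g: "smooth A B g" and smooth_h: "smooth A B h"
    and gh: "\<And>t u. t \<in> A \<Longrightarrow> u \<in> B \<Longrightarrow> dt g t u = h t u * du g t u - g t u * du h t u"
begin

definition L :: "(real \<Rightarrow> real \<Rightarrow> real) \<Rightarrow> real \<Rightarrow> real \<Rightarrow> real" where
  "L f t u = dt f t u - h t u * du f t u"

definition F :: "(real \<Rightarrow> real \<Rightarrow> real) \<Rightarrow> real \<Rightarrow> real \<Rightarrow> real" where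
  "F f t u = g t u * du f t u"

lemma smooth_L: "smooth A B f \<Longrightarrow> smooth A B (L f)"
  unfolding L_def
  by (intro smooth_diff smooth_mult smooth_dt smooth_du open_A open_B smooth_h)

lemma smooth_F: "smooth A B f \<Longrightarrow> smooth A B (F f)"
  unfolding F_def by (intro smooth_mult smooth_du open_A open_B smooth_g)

lemma L_F_commute:
  assumes f: "smooth A B f" and tu: "t \<in> A" "u \<in> B"
  shows "L (F f) t u = F (L f) t u"
proof -
  note sdu = smooth_du[OF open_A open_B f] and sdt = smooth_dt[OF open_A open_B f]
  have "dt (F f) t u = dt g t u * du f t u + g t u * dt (du f) t u"
    unfolding F_def by (intro dt_eqI) (auto intro!: derivative_eq_intros smooth_has_dt smooth_g sdu tu)
  moreover have "du (F f) t u = du g t u * du f t u + g t u * du (du f) t u"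
    unfolding F_def by (intro du_eqI) (auto intro!: derivative_eq_intros smooth_has_du smooth_g sdu tu)
  moreover have "du (L f) t u = du (dt f) t u - du h t u * du f t u - h t u * du (du f) t u"
    unfolding L_def
    by (intro du_eqI) (auto intro!: derivative_eq_intros smooth_has_du smooth_h sdu sdt tu)
  ultimately show ?thesis
    using du_dt_commute[OF open_A open_B f tu] gh[OF tu]
    unfolding L_def[of "F f"] F_def[of "L f"] by algebra
qed

text \<open>Write \<open>\<partial>\<close> for the derivative in the angle.  Since \<open>L p\<close> depends on time only, \<open>L\<close> kills
  \<open>\<partial>p\<close>, \<open>\<partial>\<partial>p\<close> and \<open>\<partial>\<partial>\<partial>p\<close>.  Applying \<open>\<partial>\<close> to the evolution equation gives
  \<open>exp (2t) p \<partial>\<partial>\<partial>p + (4p - 2) \<partial>p = 0\<close>; applying \<open>L\<close> to this and eliminating \<open>\<partial>\<partial>\<partial>p\<close> leaves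
  \<open>\<partial>p (L p - 4 p\<^sup>2 + 2 p) = 0\<close>.  Two more derivatives in the angle force \<open>\<partial>p = 0\<close>, because where
  \<open>\<partial>p \<noteq> 0\<close> the value of \<open>p\<close> would be a root of a nontrivial quadratic polynomial whose coefficients
  depend on time only.\<close>

lemma separated_pressure_constant:
  assumes p: "smooth A B p"
    and evol: "\<And>t u. t \<in> A \<Longrightarrow> u \<in> B \<Longrightarrow>
      L p t u = exp (2 * t) * (p t u * F (F p) t u - (F p t u)\<^sup>2 / 2) + 2 * (p t u)\<^sup>2 - 2 * p t u"
    and sep: "\<And>t u. t \<in> A \<Longrightarrow> u \<in> B \<Longrightarrow> du (L p) t u = 0"
    and tu: "t \<in> A" "u \<in> B"
  shows "F p t u = 0"
proof -
  define P1 P2 P3 where "P1 = F p" and "P2 = F P1" and "P3 = F P2"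
  note P = P1_def P2_def P3_def
  have sm: "smooth A B P1" "smooth A B P2" "smooth A B P3" "smooth A B (L p)" "smooth A B p"
    unfolding P by (intro smooth_F smooth_L p)+
  have LF0: "L (F f) t u = 0"
    if "smooth A B f" "\<And>t u. t \<in> A \<Longrightarrow> u \<in> B \<Longrightarrow> du (L f) t u = 0" "t \<in> A" "u \<in> B" for f t u
    using L_F_commute[OF that(1,3,4)] that(2-4) by (simp add: F_def)
  have LP1: "L P1 t u = 0" if "t \<in> A" "u \<in> B" for t u
    unfolding P1_def using that by (intro LF0 p sep)
  have LP2: "L P2 t u = 0" if "t \<in> A" "u \<in> B" for t u
    unfolding P2_def using that by (intro LF0 sm du_zero[OF open_B] LP1)
  have LP3: "L P3 t u = 0" if "t \<in> A" "u \<in> B" for t u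
    unfolding P3_def using that by (intro LF0 sm du_zero[OF open_B] LP2)
  note dui = smooth_has_du[OF sm(1)] smooth_has_du[OF sm(2)] smooth_has_du[OF sm(3)]
    smooth_has_du[OF sm(4)] smooth_has_du[OF sm(5)]
  note dti = smooth_has_dt[OF sm(1)] smooth_has_dt[OF sm(2)] smooth_has_dt[OF sm(3)]
    smooth_has_dt[OF sm(5)]
  have E1: "exp (2 * t) * (p t u * P3 t u) + 4 * (p t u * P1 t u) - 2 * P1 t u = 0"
    if tu: "t \<in> A" "u \<in> B" for t u
  proof -
    let ?R = "\<lambda>t u. exp (2 * t) * (p t u * P2 t u - (P1 t u)\<^sup>2 / 2) + 2 * (p t u)\<^sup>2 - 2 * p t u"
    have "du ?R t u = exp (2 * t) * (du p t u * P2 t u + p t u * du P2 t u - P1 t u * du P1 t u)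
        + 4 * (p t u * du p t u) - 2 * du p t u"
      by (rule du_eqI) (auto intro!: derivative_eq_intros dui tu simp: algebra_simps)
    moreover have "du (L p) t u = du ?R t u"
      by (rule du_cong[OF open_B tu(2)]) (use evol tu P in auto)
    ultimately have "exp (2 * t) * (du p t u * P2 t u + p t u * du P2 t u - P1 t u * du P1 t u)
        + 4 * (p t u * du p t u) - 2 * du p t u = 0"
      using sep tu by simp
    then have "g t u * (exp (2 * t) * (du p t u * P2 t u + p t u * du P2 t u - P1 t u * du P1 t u)
        + 4 * (p t u * du p t u) - 2 * du p t u) = 0" by simp
    then show ?thesis unfolding P3_def F_def[of P2] P2_def F_def[of P1]
      by (simp add: P1_def F_def algebra_simps)
  qed
  have E2: "2 * (exp (2 * t) * p t u * P3 t u) + exp (2 * t) * (L p t u * P3 t u)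
      + 4 * (L p t u * P1 t u) = 0" if tu: "t \<in> A" "u \<in> B" for t u
  proof -
    let ?N = "\<lambda>t u. exp (2 * t) * (p t u * P3 t u) + 4 * (p t u * P1 t u) - 2 * P1 t u"
    have "dt ?N t u = 0" "du ?N t u = 0"
      by (rule dt_zero[OF open_A tu(1)] du_zero[OF open_B tu(2)]; use E1 tu in auto)+
    moreover have "dt ?N t u = 2 * exp (2 * t) * (p t u * P3 t u)
        + exp (2 * t) * (dt p t u * P3 t u + p t u * dt P3 t u)
        + 4 * (dt p t u * P1 t u + p t u * dt P1 t u) - 2 * dt P1 t u"
      by (rule dt_eqI) (auto intro!: derivative_eq_intros dti tu simp: algebra_simps)
    moreover have "du ?N t u = exp (2 * t) * (du p t u * P3 t u + p t u * du P3 t u)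
        + 4 * (du p t u * P1 t u + p t u * du P1 t u) - 2 * du P1 t u"
      by (rule du_eqI) (auto intro!: derivative_eq_intros dui tu simp: algebra_simps)
    moreover have "dt P1 t u = h t u * du P1 t u" "dt P3 t u = h t u * du P3 t u"
      using LP1[OF tu] LP3[OF tu] by (auto simp: L_def)
    moreover have "dt p t u = L p t u + h t u * du p t u" by (simp add: L_def)
    ultimately show ?thesis by algebra
  qed
  have E3: "P1 t u * (L p t u - 4 * (p t u)\<^sup>2 + 2 * p t u) = 0" if tu: "t \<in> A" "u \<in> B" for t u
    using E1[OF tu] E2[OF tu] by algebra
  \<comment> \<open>the product with \<open>P1\<close> removes the term containing the derivative of \<open>P1\<close>, here and in the next step\<close>
  have E4: "P1 t u * (8 * p t u - 2) = 0" if tu: "t \<in> A" "u \<in> B" for t u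
  proof -
    let ?N = "\<lambda>t u. P1 t u * (L p t u - 4 * (p t u)\<^sup>2 + 2 * p t u)"
    have "du ?N t u = 0" by (rule du_zero[OF open_B tu(2)]; use E3 tu in auto)
    moreover have "du ?N t u = du P1 t u * (L p t u - 4 * (p t u)\<^sup>2 + 2 * p t u)
        + P1 t u * (du (L p) t u - 8 * (p t u * du p t u) + 2 * du p t u)"
      by (rule du_eqI) (auto intro!: derivative_eq_intros dui tu simp: algebra_simps)
    moreover have "P1 t u = g t u * du p t u" by (simp add: P1_def F_def)
    ultimately have "(P1 t u) ^ 3 * (8 * p t u - 2) = 0"
      using sep[OF tu] E3[OF tu] by algebra
    then show ?thesis by auto
  qed
  have E5: "(P1 t u) ^ 3 = 0"
  proof -
    let ?N = "\<lambda>t u. P1 t u * (8 * p t u - 2)"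
    have "du ?N t u = 0" by (rule du_zero[OF open_B tu(2)]; use E4 tu in auto)
    moreover have "du ?N t u = du P1 t u * (8 * p t u - 2) + P1 t u * (8 * du p t u)"
      by (rule du_eqI) (auto intro!: derivative_eq_intros dui tu simp: algebra_simps)
    moreover have "P1 t u = g t u * du p t u" by (simp add: P1_def F_def)
    ultimately show ?thesis using E4[OF tu] by algebra
  qed
  then show ?thesis by (simp add: P1_def)
qed

end

section \<open>Evolution of speed and curvature\<close>

text \<open>A moving curve \<open>(x, y)\<close> with hyperbolic speed \<open>v\<close>, Euclidean unit tangent \<open>(c, s)\<close>, geodesic
  curvature \<open>k\<close>, normal velocity \<open>k\<close> and tangential velocity \<open>w\<close>.  Equality of the mixed second
  derivatives of the position gives the evolution of \<open>v\<close> and the rotation speed of the tangent;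
  equality of those of the tangent then gives the evolution of \<open>k\<close>, in which the term \<open>- k\<close> is the
  Gauss curvature \<open>-1\<close> times \<open>k\<close>.\<close>

lemma curvature_evolution:
  assumes AB: "open A" "open B"
    and sm: "smooth A B x" "smooth A B y" "smooth A B v" "smooth A B c" "smooth A B s"
      "smooth A B k" "smooth A B w"
    and pos: "\<And>t u. t \<in> A \<Longrightarrow> u \<in> B \<Longrightarrow> v t u > 0" "\<And>t u. t \<in> A \<Longrightarrow> u \<in> B \<Longrightarrow> y t u > 0"
    and xu: "\<And>t u. t \<in> A \<Longrightarrow> u \<in> B \<Longrightarrow> du x t u = v t u * y t u * c t u"
    and yu: "\<And>t u. t \<in> A \<Longrightarrow> u \<in> B \<Longrightarrow> du y t u = v t u * y t u * s t u"
    and cs: "\<And>t u. t \<in> A \<Longrightarrow> u \<in> B \<Longrightarrow> (c t u)\<^sup>2 + (s t u)\<^sup>2 = 1"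
    and cu: "\<And>t u. t \<in> A \<Longrightarrow> u \<in> B \<Longrightarrow> du c t u = - (v t u * (k t u - c t u) * s t u)"
    and su: "\<And>t u. t \<in> A \<Longrightarrow> u \<in> B \<Longrightarrow> du s t u = v t u * (k t u - c t u) * c t u"
    and xt: "\<And>t u. t \<in> A \<Longrightarrow> u \<in> B \<Longrightarrow> dt x t u = y t u * (w t u * c t u - k t u * s t u)"
    and yt: "\<And>t u. t \<in> A \<Longrightarrow> u \<in> B \<Longrightarrow> dt y t u = y t u * (w t u * s t u + k t u * c t u)"
    and tu: "t \<in> A" "u \<in> B"
  defines "q \<equiv> \<lambda>t u. du k t u / v t u"
  shows "dt v t u = du w t u - v t u * (k t u)\<^sup>2"
    and "v t u * dt k t u = du q t u + w t u * du k t u + v t u * ((k t u) ^ 3 - k t u)"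
proof -
  note smu = sm[THEN smooth_du[OF AB]] and smt = sm[THEN smooth_dt[OF AB]]
  have smq: "smooth A B q" unfolding q_def by (intro smooth_divide AB smu sm pos)
  note di = derivative_eq_intros sm[THEN smooth_has_dt] sm[THEN smooth_has_du]
    smu[THEN smooth_has_dt] smu[THEN smooth_has_du] smt[THEN smooth_has_du] smq[THEN smooth_has_du]
  define W where "W = (\<lambda>t u. du k t u + v t u * k t u * s t u + v t u * w t u * (k t u - c t u))"
  have first: "dt v t u = du w t u - v t u * (k t u)\<^sup>2 \<and> v t u * dt c t u = - (s t u * W t u) \<and>
      v t u * dt s t u = c t u * W t u" if tu: "t \<in> A" "u \<in> B" for t u
  proof -
    have "dt (du x) t u = dt (\<lambda>t u. v t u * y t u * c t u) t u"
      by (rule dt_cong[OF AB(1) tu(1)]) (use xu tu in auto)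
    also have "\<dots> = dt v t u * y t u * c t u + v t u * dt y t u * c t u + v t u * y t u * dt c t u"
      by (rule dt_eqI) (auto intro!: di tu simp: algebra_simps)
    finally have x1: "dt (du x) t u = \<dots>" .
    have "du (dt x) t u = du (\<lambda>t u. y t u * (w t u * c t u - k t u * s t u)) t u"
      by (rule du_cong[OF AB(2) tu(2)]) (use xt tu in auto)
    also have "\<dots> = du y t u * (w t u * c t u - k t u * s t u) + y t u *
       (du w t u * c t u + w t u * du c t u - du k t u * s t u - k t u * du s t u)"
      by (rule du_eqI) (auto intro!: di tu simp: algebra_simps)
    finally have x2: "du (dt x) t u = \<dots>" .
    have "dt (du y) t u = dt (\<lambda>t u. v t u * y t u * s t u) t u"
      by (rule dt_cong[OF AB(1) tu(1)]) (use yu tu in auto)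
    also have "\<dots> = dt v t u * y t u * s t u + v t u * dt y t u * s t u + v t u * y t u * dt s t u"
      by (rule dt_eqI) (auto intro!: di tu simp: algebra_simps)
    finally have y1: "dt (du y) t u = \<dots>" .
    have "du (dt y) t u = du (\<lambda>t u. y t u * (w t u * s t u + k t u * c t u)) t u"
      by (rule du_cong[OF AB(2) tu(2)]) (use yt tu in auto)
    also have "\<dots> = du y t u * (w t u * s t u + k t u * c t u) + y t u *
       (du w t u * s t u + w t u * du s t u + du k t u * c t u + k t u * du c t u)"
      by (rule du_eqI) (auto intro!: di tu simp: algebra_simps)
    finally have y2: "du (dt y) t u = \<dots>" .
    have "dt (\<lambda>t u. (c t u)\<^sup>2 + (s t u)\<^sup>2 - 1) t u = 0"
      by (rule dt_zero[OF AB(1) tu(1)]) (use cs tu in auto)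
    moreover have "dt (\<lambda>t u. (c t u)\<^sup>2 + (s t u)\<^sup>2 - 1) t u = 2 * (c t u * dt c t u + s t u * dt s t u)"
      by (rule dt_eqI) (auto intro!: di tu simp: algebra_simps)
    ultimately have o: "c t u * dt c t u + s t u * dt s t u = 0" by simp
    note eqs = x1 x2 y1 y2 o du_dt_commute[OF AB sm(1) tu] du_dt_commute[OF AB sm(2) tu]
      xu[OF tu] yu[OF tu] cu[OF tu] su[OF tu] xt[OF tu] yt[OF tu] cs[OF tu]
    have "y t u * (dt v t u - du w t u + v t u * (k t u)\<^sup>2) = 0" using eqs by algebra
    moreover have "y t u * (v t u * dt c t u + s t u * W t u) = 0"
      using eqs unfolding W_def by algebra
    moreover have "y t u * (v t u * dt s t u - c t u * W t u) = 0"
      using eqs unfolding W_def by algebra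
    ultimately show ?thesis using pos(2)[OF tu] by simp
  qed
  then show "dt v t u = du w t u - v t u * (k t u)\<^sup>2" using tu by blast
  define Wu where "Wu = du (du k) t u + du v t u * k t u * s t u + v t u * du k t u * s t u
    + v t u * k t u * du s t u + du v t u * w t u * (k t u - c t u)
    + v t u * du w t u * (k t u - c t u) + v t u * w t u * (du k t u - du c t u)"
  have W: "(W t has_real_derivative Wu) (at u)"
    unfolding W_def Wu_def by (auto intro!: di tu simp: algebra_simps)
  have c1: "dt (du c) t u = - (dt v t u * (k t u - c t u) * s t u
      + v t u * (dt k t u - dt c t u) * s t u + v t u * (k t u - c t u) * dt s t u)"
  proof -
    have "dt (du c) t u = dt (\<lambda>t u. - (v t u * (k t u - c t u) * s t u)) t u"
      by (rule dt_cong[OF AB(1) tu(1)]) (use cu tu in auto)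
    also have "\<dots> = - (dt v t u * (k t u - c t u) * s t u
      + v t u * (dt k t u - dt c t u) * s t u + v t u * (k t u - c t u) * dt s t u)"
      by (rule dt_eqI) (auto intro!: di tu simp: algebra_simps)
    finally show ?thesis .
  qed
  have s1: "dt (du s) t u = dt v t u * (k t u - c t u) * c t u
      + v t u * (dt k t u - dt c t u) * c t u + v t u * (k t u - c t u) * dt c t u"
  proof -
    have "dt (du s) t u = dt (\<lambda>t u. v t u * (k t u - c t u) * c t u) t u"
      by (rule dt_cong[OF AB(1) tu(1)]) (use su tu in auto)
    also have "\<dots> = dt v t u * (k t u - c t u) * c t u
      + v t u * (dt k t u - dt c t u) * c t u + v t u * (k t u - c t u) * dt c t u"
      by (rule dt_eqI) (auto intro!: di tu simp: algebra_simps)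
    finally show ?thesis .
  qed
  have c2: "du v t u * dt c t u + v t u * du (dt c) t u + du s t u * W t u + s t u * Wu = 0"
  proof -
    have "du (\<lambda>t u. v t u * dt c t u + s t u * W t u) t u = 0"
      by (rule du_zero[OF AB(2) tu(2)]) (use first tu in auto)
    moreover have "du (\<lambda>t u. v t u * dt c t u + s t u * W t u) t u =
      du v t u * dt c t u + v t u * du (dt c) t u + du s t u * W t u + s t u * Wu"
      by (rule du_eqI) (auto intro!: di tu W simp: algebra_simps)
    ultimately show ?thesis by simp
  qed
  have s2: "du v t u * dt s t u + v t u * du (dt s) t u - du c t u * W t u - c t u * Wu = 0"
  proof -
    have "du (\<lambda>t u. v t u * dt s t u - c t u * W t u) t u = 0"
      by (rule du_zero[OF AB(2) tu(2)]) (use first tu in auto)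
    moreover have "du (\<lambda>t u. v t u * dt s t u - c t u * W t u) t u =
      du v t u * dt s t u + v t u * du (dt s) t u - du c t u * W t u - c t u * Wu"
      by (rule du_eqI) (auto intro!: di tu W simp: algebra_simps)
    ultimately show ?thesis by simp
  qed
  have q: "du (du k) t u = du v t u * q t u + v t u * du q t u"
  proof -
    have "du (du k) t u = du (\<lambda>t u. v t u * q t u) t u"
      by (rule du_cong[OF AB(2) tu(2)]) (use pos(1) tu in \<open>auto simp: q_def less_imp_neq[symmetric]\<close>)
    also have "\<dots> = du v t u * q t u + v t u * du q t u"
      by (rule du_eqI) (auto intro!: di tu simp: algebra_simps)
    finally show ?thesis .
  qed
  have ku: "du k t u = v t u * q t u" using pos(1)[OF tu] by (simp add: q_def)
  have f: "dt v t u = du w t u - v t u * (k t u)\<^sup>2" "v t u * dt c t u = - (s t u * W t u)"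
      "v t u * dt s t u = c t u * W t u" using first[OF tu] by auto
  have ortho: "c t u * du c t u + s t u * du s t u = 0" by (simp add: cu[OF tu] su[OF tu])
  \<comment> \<open>the rotation speed \<open>c s\<^sub>t - s c\<^sub>t\<close> of the tangent is \<open>W / v\<close>; its \<open>u\<close>-derivative is computed twice\<close>
  have "v t u * (c t u * dt (du s) t u - s t u * dt (du c) t u)
      = v t u * (dt v t u * (k t u - c t u) + v t u * dt k t u) + v t u * s t u * W t u"
    using f(2,3) cs[OF tu] unfolding c1 s1 by algebra
  moreover have "v t u * (v t u * (c t u * du (dt s) t u - s t u * du (dt c) t u))
      = v t u * Wu - du v t u * W t u"
    using f(2,3) cs[OF tu] ortho c2 s2 by algebra
  ultimately have "v t u * (v t u * (dt v t u * (k t u - c t u) + v t u * dt k t u) + v t u * s t u * W t u)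
      = v t u * Wu - du v t u * W t u"
    using du_dt_commute[OF AB sm(4) tu] du_dt_commute[OF AB sm(5) tu] by simp
  then have "(v t u)\<^sup>2 * (v t u * dt k t u - (du q t u + w t u * du k t u + v t u * ((k t u) ^ 3 - k t u))) = 0"
    using cs[OF tu] unfolding Wu_def W_def f(1) q ku cu[OF tu] su[OF tu] by algebra
  then show "v t u * dt k t u = du q t u + w t u * du k t u + v t u * ((k t u) ^ 3 - k t u)"
    using pos(1)[OF tu] by simp
qed

text \<open>Here \<open>q\<close> is the arc-length derivative of the curvature.  The form
  \<open>exp t (k v du + (k w + q) dt)\<close> is closed by the two evolution equations: it is the differential of
  the angle when the correction factor is \<open>exp (- t)\<close>.  Hence \<open>g\<close> and \<open>h\<close> below form a commuting
  frame, and the evolution of \<open>k\<close> becomes the pressure equation for \<open>k\<^sup>2\<close>.\<close>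

lemma separated_curvature_constant:
  assumes AB: "open A" "open B"
    and sm: "smooth A B v" "smooth A B k" "smooth A B w"
    and pos: "\<And>t u. t \<in> A \<Longrightarrow> u \<in> B \<Longrightarrow> v t u > 0" "\<And>t u. t \<in> A \<Longrightarrow> u \<in> B \<Longrightarrow> k t u > 0"
    and vt: "\<And>t u. t \<in> A \<Longrightarrow> u \<in> B \<Longrightarrow> dt v t u = du w t u - v t u * (k t u)\<^sup>2"
    and kt: "\<And>t u. t \<in> A \<Longrightarrow> u \<in> B \<Longrightarrow>
      v t u * dt k t u = du q t u + w t u * du k t u + v t u * ((k t u) ^ 3 - k t u)"
    and q: "q = (\<lambda>t u. du k t u / v t u)"
    and h: "h = (\<lambda>t u. (w t u + q t u / k t u) / v t u)"
    and sep: "\<And>t u. t \<in> A \<Longrightarrow> u \<in> B \<Longrightarrow>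
      du (\<lambda>t u. dt (\<lambda>t u. (k t u)\<^sup>2) t u - h t u * du (\<lambda>t u. (k t u)\<^sup>2) t u) t u = 0"
    and tu: "t \<in> A" "u \<in> B"
  shows "du k t u = 0"
proof -
  have smq: "smooth A B q" unfolding q by (intro smooth_divide smooth_du AB sm pos)
  have smh: "smooth A B h" unfolding h by (intro smooth_divide smooth_add AB sm smq pos)
  define g where "g = (\<lambda>t u. exp (- 1 * t) / (k t u * v t u))"
  have smg: "smooth A B g" unfolding g_def
    by (intro smooth_divide smooth_mult smooth_exp AB sm mult_pos_pos pos)
  define p where "p = (\<lambda>t u. (k t u)\<^sup>2)"
  have smp: "smooth A B p" unfolding p_def by (intro smooth_power sm)
  note di = derivative_eq_intros sm[THEN smooth_has_dt] sm[THEN smooth_has_du]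
    smq[THEN smooth_has_du]
  have ku: "du k t u = v t u * q t u" if "t \<in> A" "u \<in> B" for t u
    using pos(1)[OF that] by (simp add: q)
  interpret commuting_frame A B g h
  proof
    fix t u assume tu: "t \<in> A" "u \<in> B"
    note p0 = pos[OF tu]
    have "dt g t u = - exp (- t) * (k t u * v t u + dt k t u * v t u + k t u * dt v t u) / (k t u * v t u)\<^sup>2"
      unfolding g_def
      by (rule dt_eqI) (use p0 in \<open>auto intro!: di tu simp: field_simps power2_eq_square\<close>)
    moreover have "du g t u = - exp (- t) * (du k t u * v t u + k t u * du v t u) / (k t u * v t u)\<^sup>2"
      unfolding g_def
      by (rule du_eqI) (use p0 in \<open>auto intro!: di tu simp: field_simps power2_eq_square\<close>)
    moreover have "du h t u = (du w t u + (du q t u * k t u - q t u * du k t u) / (k t u)\<^sup>2) / v t u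
        - (w t u + q t u / k t u) * du v t u / (v t u)\<^sup>2"
      unfolding h
      by (rule du_eqI) (use p0 in \<open>auto intro!: di tu simp: field_simps power2_eq_square\<close>)
    moreover have "dt k t u = (du q t u + w t u * du k t u) / v t u + ((k t u) ^ 3 - k t u)"
      using kt[OF tu] p0 by (simp add: field_simps)
    ultimately show "dt g t u = h t u * du g t u - g t u * du h t u"
      using p0 unfolding g_def h vt[OF tu] ku[OF tu] by (simp add: field_simps) algebra
  qed (use AB smg smh in auto)
  have dup: "du p t u = 2 * k t u * du k t u" if "t \<in> A" "u \<in> B" for t u
    unfolding p_def by (rule du_eqI) (auto intro!: di that)
  have dtp: "dt p t u = 2 * k t u * dt k t u" if "t \<in> A" "u \<in> B" for t u
    unfolding p_def by (rule dt_eqI) (auto intro!: di that)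
  have Fp: "F p t u = 2 * exp (- t) * q t u" if "t \<in> A" "u \<in> B" for t u
    using pos[OF that] unfolding F_def unfolding dup[OF that] ku[OF that] g_def by simp
  have FFp: "F (F p) t u = 2 * (exp (- t))\<^sup>2 * du q t u / (k t u * v t u)" if tu: "t \<in> A" "u \<in> B" for t u
  proof -
    have "du (F p) t u = du (\<lambda>t u. 2 * exp (- t) * q t u) t u"
      by (rule du_cong[OF AB(2) tu(2)]) (use Fp tu in auto)
    also have "\<dots> = 2 * exp (- t) * du q t u"
      by (rule du_eqI) (auto intro!: di tu)
    finally have e: "du (F p) t u = 2 * exp (- t) * du q t u" .
    show ?thesis unfolding F_def[of "F p"] e by (simp add: g_def power2_eq_square)
  qed
  have "F p t u = 0"
  proof (rule separated_pressure_constant[OF smp _ _ tu])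
    fix t u assume tu: "t \<in> A" "u \<in> B"
    note p0 = pos[OF tu]
    show "du (L p) t u = 0" using sep[OF tu] by (simp add: L_def[abs_def] p_def)
    have e: "exp (2 * t) * (exp (- t))\<^sup>2 = 1"
      by (simp add: power2_eq_square mult_exp_exp)
    have "exp (2 * t) * (p t u * F (F p) t u - (F p t u)\<^sup>2 / 2)
      = (exp (2 * t) * (exp (- t))\<^sup>2) * (2 * p t u * du q t u / (k t u * v t u) - 2 * (q t u)\<^sup>2)"
      unfolding FFp[OF tu] Fp[OF tu] by (simp add: power_mult_distrib algebra_simps)
    also have "\<dots> = 2 * k t u * du q t u / v t u - 2 * (q t u)\<^sup>2"
      unfolding e using p0 by (simp add: p_def field_simps power2_eq_square)
    finally have R: "exp (2 * t) * (p t u * F (F p) t u - (F p t u)\<^sup>2 / 2) = \<dots>" .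
    have kt': "dt k t u = (du q t u + w t u * du k t u) / v t u + ((k t u) ^ 3 - k t u)"
      using kt[OF tu] p0 by (simp add: field_simps)
    show "L p t u = exp (2 * t) * (p t u * F (F p) t u - (F p t u)\<^sup>2 / 2) + 2 * (p t u)\<^sup>2 - 2 * p t u"
      unfolding R L_def unfolding dup[OF tu] dtp[OF tu] unfolding kt' ku[OF tu] h p_def
      using p0 by (simp add: field_simps) algebra
  qed
  then show ?thesis using Fp[OF tu] ku[OF tu] by simp
qed

section \<open>Separated functions along the level sets of the angle\<close>

lemma smooth_has_derivative:
  assumes AB: "open A" "open B" "convex B" and f: "smooth A B f" and tu: "t \<in> A" "u \<in> B"
  shows "((\<lambda>(t, u). f t u) has_derivative (\<lambda>(x, y). dt f t u * x + du f t u * y)) (at (t, u))"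
proof -
  have "((\<lambda>(t, u). f t u) has_derivative
      (\<lambda>(x, y). (\<lambda>x. dt f t u * x) x + blinfun_apply (blinfun_mult_right (du f t u)) y)) (at (t, u) within A \<times> B)"
  proof (rule has_derivative_partialsI)
    show "((\<lambda>x. f x u) has_derivative (*) (dt f t u)) (at t within A)"
      using smooth_has_dt[OF f tu]
      by (simp add: has_field_derivative_def has_derivative_at_withinI)
    show "((\<lambda>y. f x y) has_derivative blinfun_apply (blinfun_mult_right (du f x y))) (at y within B)"
      if "x \<in> A" "y \<in> B" for x y
      using smooth_has_du[OF f that]
      by (simp add: has_field_derivative_def has_derivative_at_withinI)
    have "continuous_on (A \<times> B) (\<lambda>z. blinfun_mult_right (du f (fst z) (snd z)))"
      using smooth_imp_continuous[OF smooth_du[OF AB(1,2) f]]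
      by (auto simp: continuous_on_rect intro!: continuous_intros
          bounded_linear.continuous_on[OF bounded_linear_blinfun_mult_right])
    then show "continuous (at (t, u) within A \<times> B) (\<lambda>(x, y). blinfun_mult_right (du f x y))"
      using tu by (auto simp: continuous_on_eq_continuous_within case_prod_beta')
  qed (use tu AB in auto)
  moreover have "at (t, u) within A \<times> B = at (t, u)"
    using AB tu by (intro at_within_open open_Times) auto
  ultimately show ?thesis by simp
qed

text \<open>In the chart \<open>(t, \<phi>)\<close> the function \<open>p\<close> becomes \<open>a + b\<close>, whose increments in time do not depend on
  the angle.  So its time derivative at a fixed angle, which in the original coordinates is
  \<open>dt p - h du p\<close>, depends on time only.  Taking increments avoids derivatives of \<open>a\<close> and \<open>b\<close>,
  which are arbitrary functions.\<close>

lemma separated_level_derivative: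
  assumes AB: "open A" "open B" "convex B"
    and f: "smooth A B f" and p: "smooth A B p"
    and fu: "\<And>t u. t \<in> A \<Longrightarrow> u \<in> B \<Longrightarrow> du f t u > 0"
    and ft: "\<And>t u. t \<in> A \<Longrightarrow> u \<in> B \<Longrightarrow> dt f t u = h t u * du f t u"
    and sep: "\<And>t u. t \<in> A \<Longrightarrow> u \<in> B \<Longrightarrow> p t u = a t + b (f t u)"
    and t: "t \<in> A" and u: "u1 \<in> B" "u2 \<in> B"
  shows "dt p t u1 - h t u1 * du p t u1 = dt p t u2 - h t u2 * du p t u2"
proof -
  define G where "G = (\<lambda>(t, u). (t, f t u))"
  have mono: "f t x < f t y" if "t \<in> A" "x \<in> B" "y \<in> B" "x < y" for t x y
  proof (rule DERIV_pos_imp_increasing[OF that(4)])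
    fix z assume "x \<le> z" "z \<le> y"
    then have "z \<in> closed_segment x y" by (auto simp: closed_segment_eq_real_ivl)
    then have "z \<in> B" using closed_segment_subset[OF that(2,3) AB(3)] by blast
    then show "\<exists>y. (f t has_real_derivative y) (at z) \<and> y > 0"
      using smooth_has_du[OF f that(1)] fu[OF that(1)] by blast
  qed
  have inj: "inj_on G (A \<times> B)"
  proof (rule inj_onI)
    fix x y assume "x \<in> A \<times> B" "y \<in> A \<times> B" "G x = G y"
    then show "x = y" using mono[of "fst x" "snd x" "snd y"] mono[of "fst x" "snd y" "snd x"]
      by (auto simp: G_def split_beta prod_eq_iff) (metis linorder_cases order_less_irrefl)
  qed
  have op: "open (A \<times> B)" using AB by (intro open_Times)
  have contG: "continuous_on (A \<times> B) G"
    using smooth_imp_continuous[OF f] unfolding G_def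
    by (auto simp: continuous_on_rect split_beta intro!: continuous_intros)
  have opG: "open (G ` (A \<times> B))" by (rule invariance_of_domain[OF contG op inj])
  define R where "R = the_inv_into (A \<times> B) G"
  have R: "R (G z) = z" if "z \<in> A \<times> B" for z
    unfolding R_def by (rule the_inv_into_f_f[OF inj that])
  define P where "P = (\<lambda>z. (\<lambda>(t, u). p t u) (R z))"
  have der: "((\<lambda>s. P (s, f t u)) has_real_derivative dt p t u - h t u * du p t u) (at t)"
    if u: "u \<in> B" for u
  proof -
    let ?G' = "\<lambda>(x, y). (x, dt f t u * x + du f t u * y)"
    let ?R' = "\<lambda>(x, y). (x, (y - dt f t u * x) / du f t u)"
    have "(G has_derivative ?G') (at (t, u))"
    proof -
      have "((\<lambda>z. (fst z, (\<lambda>(t, u). f t u) z)) has_derivative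
          (\<lambda>z. (fst z, (\<lambda>(x, y). dt f t u * x + du f t u * y) z))) (at (t, u))"
        by (intro has_derivative_Pair smooth_has_derivative[OF AB f t u] derivative_intros) 
      then show ?thesis by (simp add: G_def case_prod_beta')
    qed
    then have "(R has_derivative ?R') (at (G (t, u)))"
      by (rule has_derivative_inverse_strong[OF op _ contG R, rotated 2])
        (use t u fu[OF t u] in \<open>auto simp: fun_eq_iff\<close>)
    then have 1: "(R has_derivative ?R') (at (t, f t u))" by (simp add: G_def)
    have "R (t, f t u) = (t, u)" using R[of "(t, u)"] t u by (simp add: G_def)
    then have 2: "((\<lambda>(t, u). p t u) has_derivative (\<lambda>(x, y). dt p t u * x + du p t u * y))
        (at (R (t, f t u)))"
      using smooth_has_derivative[OF AB p t u] by simp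
    have 3: "((\<lambda>s. (s, f t u)) has_derivative (\<lambda>x. (x, 0))) (at t)"
      by (auto intro!: derivative_eq_intros)
    have "((\<lambda>s. P (s, f t u)) has_derivative
        (\<lambda>x. (\<lambda>(x, y). dt p t u * x + du p t u * y) (?R' (x, 0)))) (at t)"
      unfolding P_def
      by (rule has_derivative_compose[OF has_derivative_compose[OF 3 1] 2])
    moreover have "(\<lambda>x. (\<lambda>(x, y). dt p t u * x + du p t u * y) (?R' (x, 0)))
        = (*) (dt p t u - h t u * du p t u)"
      using fu[OF t u] ft[OF t u] by (auto simp: fun_eq_iff field_simps)
    ultimately show ?thesis by (simp add: has_field_derivative_def)
  qed
  have P: "P (s, f t u) = a s + b (f t u)" if su: "(s, f t u) \<in> G ` (A \<times> B)" for s u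
  proof -
    obtain u' where u': "s \<in> A" "u' \<in> B" "f t u = f s u'" using su by (auto simp: G_def)
    then have "P (s, f t u) = p s u'" using R[of "(s, u')"] by (simp add: G_def P_def)
    then show ?thesis using sep u' by simp
  qed
  have ev: "\<forall>\<^sub>F s in nhds t. (s, f t u) \<in> G ` (A \<times> B)" if u: "u \<in> B" for u
  proof -
    have "((\<lambda>s. (s, f t u)) \<longlongrightarrow> (t, f t u)) (nhds t)"
      by (intro tendsto_intros) (simp add: filterlim_ident)
    moreover have "(t, f t u) \<in> G ` (A \<times> B)" using t u by (force simp: G_def)
    ultimately show ?thesis using opG topological_tendstoD by blast
  qed
  have "((\<lambda>s. P (s, f t u1) - P (s, f t u2)) has_real_derivative
      (dt p t u1 - h t u1 * du p t u1) - (dt p t u2 - h t u2 * du p t u2)) (at t)"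
    by (intro DERIV_diff der u)
  moreover have "((\<lambda>s. P (s, f t u1) - P (s, f t u2)) has_real_derivative 0) (at t)"
  proof -
    have "\<forall>\<^sub>F s in nhds t. P (s, f t u1) - P (s, f t u2) = b (f t u1) - b (f t u2)"
      using ev[OF u(1)] ev[OF u(2)] by eventually_elim (simp add: P)
    then show ?thesis by (subst DERIV_cong_ev[OF refl _ refl]) auto
  qed
  ultimately show ?thesis using DERIV_unique by fastforce
qed

section \<open>The Euclidean frame of an immersed curve\<close>

lemma at_within_interval_neq_bot:
  fixes I :: "real set"
  assumes "is_interval I" "u \<in> I" "I \<noteq> {u}"
  shows "at u within I \<noteq> bot"
proof -
  have "u islimpt I"
  proof (rule connected_imp_perfect)
    show "connected I" using assms(1) is_interval_connected_1 by blast
    show "I \<noteq> {x}" for x using assms(2,3) by auto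
  qed (use assms in auto)
  then show ?thesis by (simp add: trivial_limit_within)
qed

lemma has_real_derivative_Re:
  "(f has_vector_derivative d) F \<Longrightarrow> ((\<lambda>u. Re (f u)) has_real_derivative Re d) F"
  using bounded_linear.has_vector_derivative[OF bounded_linear_Re]
  by (simp add: has_real_derivative_iff_has_vector_derivative)

lemma has_real_derivative_Im:
  "(f has_vector_derivative d) F \<Longrightarrow> ((\<lambda>u. Im (f u)) has_real_derivative Im d) F"
  using bounded_linear.has_vector_derivative[OF bounded_linear_Im]
  by (simp add: has_real_derivative_iff_has_vector_derivative)

text \<open>\<open>C + \<i> S\<close> is the Euclidean unit tangent and \<open>v\<close> the hyperbolic speed.  The tangent turns at the
  rate \<open>k - C\<close> per unit of hyperbolic arc length: a horizontal line, along which it does not turn,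
  has curvature \<open>1\<close> when it runs to the right.\<close>

lemma euclidean_frame:
  fixes \<gamma> :: "real \<Rightarrow> complex" and I :: "real set"
  assumes I: "is_interval I" "u \<in> I" "I \<noteq> {u}"
    and d1: "\<And>u. u \<in> I \<Longrightarrow> (\<gamma> has_vector_derivative \<gamma>1 u) (at u within I)"
    and d2: "\<And>u. u \<in> I \<Longrightarrow> (\<gamma>1 has_vector_derivative \<gamma>2 u) (at u within I)"
    and nz: "\<And>u. u \<in> I \<Longrightarrow> \<gamma>1 u \<noteq> 0" and up: "\<And>u. u \<in> I \<Longrightarrow> Im (\<gamma> u) > 0"
  defines "v \<equiv> \<lambda>u. cmod (\<gamma>1 u) / Im (\<gamma> u)"
    and "C \<equiv> \<lambda>u. Re (\<gamma>1 u) / cmod (\<gamma>1 u)" and "S \<equiv> \<lambda>u. Im (\<gamma>1 u) / cmod (\<gamma>1 u)"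
    and "k \<equiv> geodesic_curvature I \<gamma>"
  shows "curve_speed I \<gamma> u = v u"
    and "unit_tangent I \<gamma> u = Im (\<gamma> u) *\<^sub>R Complex (C u) (S u)"
    and "unit_normal I \<gamma> u = Im (\<gamma> u) *\<^sub>R Complex (- S u) (C u)"
    and "(C u)\<^sup>2 + (S u)\<^sup>2 = 1" and "v u > 0"
    and "Re (\<gamma>1 u) = v u * Im (\<gamma> u) * C u" and "Im (\<gamma>1 u) = v u * Im (\<gamma> u) * S u"
    and "(C has_real_derivative - (v u * (k u - C u) * S u)) (at u within I)"
    and "(S has_real_derivative v u * (k u - C u) * C u) (at u within I)"
proof -
  have nb: "at x within I \<noteq> bot" if "x \<in> I" for x
    using at_within_interval_neq_bot[of I x] I that by blast
  have vd: "vector_derivative \<gamma> (at x within I) = \<gamma>1 x" if "x \<in> I" for x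
    using vector_derivative_within[OF nb d1] that by blast
  have sp: "curve_speed I \<gamma> x = v x" if "x \<in> I" for x
    using up[OF that] unfolding curve_speed_def vd[OF that] hyp_norm_def hyp_inner_def v_def
    by (simp add: real_sqrt_divide dot_square_norm)
  have ut: "unit_tangent I \<gamma> x = Im (\<gamma> x) *\<^sub>R Complex (C x) (S x)" if "x \<in> I" for x
    using up[OF that] nz[OF that]
    unfolding unit_tangent_def arc_deriv_def vd[OF that] sp[OF that]
    by (simp add: v_def C_def S_def complex_eq_iff field_simps)
  have un: "unit_normal I \<gamma> x = Im (\<gamma> x) *\<^sub>R Complex (- S x) (C x)" if "x \<in> I" for x
    unfolding unit_normal_def ut[OF that] by (simp add: complex_eq_iff)
  have one: "(C x)\<^sup>2 + (S x)\<^sup>2 = 1" if "x \<in> I" for x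
    using nz[OF that] unfolding C_def S_def
    by (simp add: power_divide add_divide_distrib[symmetric] cmod_power2[symmetric])
  show "curve_speed I \<gamma> u = v u" by (rule sp[OF I(2)])
  show "unit_tangent I \<gamma> u = Im (\<gamma> u) *\<^sub>R Complex (C u) (S u)" by (rule ut[OF I(2)])
  show un': "unit_normal I \<gamma> u = Im (\<gamma> u) *\<^sub>R Complex (- S u) (C u)" by (rule un[OF I(2)])
  show one': "(C u)\<^sup>2 + (S u)\<^sup>2 = 1" by (rule one[OF I(2)])
  show v0: "v u > 0" using nz[OF I(2)] up[OF I(2)] by (simp add: v_def)
  show re: "Re (\<gamma>1 u) = v u * Im (\<gamma> u) * C u" and im: "Im (\<gamma>1 u) = v u * Im (\<gamma> u) * S u"
    using up[OF I(2)] nz[OF I(2)] by (auto simp: v_def C_def S_def)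
  have y0: "Im (\<gamma> u) > 0" by (rule up[OF I(2)])
  note dRe = has_real_derivative_Re[OF d2[OF I(2)]] and dIm = has_real_derivative_Im[OF d2[OF I(2)]]
  have pos: "(Re (\<gamma>1 u))\<^sup>2 + (Im (\<gamma>1 u))\<^sup>2 > 0"
    using nz[OF I(2)] by (simp add: complex_eq_iff sum_power2_gt_zero_iff)
  have "\<exists>d. ((\<lambda>u. cmod (\<gamma>1 u)) has_real_derivative d) (at u within I)"
    unfolding cmod_def by (rule exI) (use pos in \<open>auto intro!: derivative_eq_intros d2[OF I(2)]\<close>)
  then obtain d where d: "((\<lambda>u. cmod (\<gamma>1 u)) has_real_derivative d) (at u within I)" by blast
  obtain c1 where c1: "(C has_real_derivative c1) (at u within I)"
    unfolding C_def using DERIV_divide[OF dRe d] nz[OF I(2)] by (metis norm_eq_zero)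
  obtain s1 where s1: "(S has_real_derivative s1) (at u within I)"
    unfolding S_def using DERIV_divide[OF dIm d] nz[OF I(2)] by (metis norm_eq_zero)
  have "((\<lambda>u. (C u)\<^sup>2 + (S u)\<^sup>2) has_real_derivative 2 * (C u * c1 + S u * s1)) (at u within I)"
    by (auto intro!: derivative_eq_intros c1 s1)
  moreover have "((\<lambda>u. (C u)\<^sup>2 + (S u)\<^sup>2) has_real_derivative 0) (at u within I)"
    unfolding has_real_derivative_iff_has_vector_derivative
    by (rule has_vector_derivative_transform[OF I(2) _ has_vector_derivative_const[of 1]])
      (use one in auto)
  ultimately have orth: "C u * c1 + S u * s1 = 0"
    using vector_derivative_unique_within[OF nb[OF I(2)]]
    unfolding has_real_derivative_iff_has_vector_derivative by fastforce
  define l where "l = C u * s1 - S u * c1"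
  have cl: "c1 = - S u * l" "s1 = C u * l"
    using orth one' unfolding l_def by algebra+
  have y1: "((\<lambda>u. Im (\<gamma> u)) has_real_derivative Im (\<gamma>1 u)) (at u within I)"
    by (rule has_real_derivative_Im[OF d1[OF I(2)]])
  have "((\<lambda>u. Complex (Im (\<gamma> u) * C u) (Im (\<gamma> u) * S u)) has_vector_derivative
      Complex (Im (\<gamma>1 u) * C u + Im (\<gamma> u) * c1) (Im (\<gamma>1 u) * S u + Im (\<gamma> u) * s1)) (at u within I)"
    unfolding has_vector_derivative_complex_iff
    by (auto intro!: derivative_eq_intros c1 s1 d1[OF I(2)])
  then have "(unit_tangent I \<gamma> has_vector_derivative
      Complex (Im (\<gamma>1 u) * C u + Im (\<gamma> u) * c1) (Im (\<gamma>1 u) * S u + Im (\<gamma> u) * s1)) (at u within I)"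
    by (rule has_vector_derivative_transform[OF I(2), rotated]) (simp add: ut complex_eq_iff)
  then have "vector_derivative (unit_tangent I \<gamma>) (at u within I) =
      Complex (Im (\<gamma>1 u) * C u + Im (\<gamma> u) * c1) (Im (\<gamma>1 u) * S u + Im (\<gamma> u) * s1)"
    by (rule vector_derivative_within[OF nb[OF I(2)]])
  then have cov: "cov_arc_deriv I \<gamma> (unit_tangent I \<gamma>) u =
      (1 / v u) *\<^sub>R Complex (Im (\<gamma>1 u) * C u + Im (\<gamma> u) * c1) (Im (\<gamma>1 u) * S u + Im (\<gamma> u) * s1)
      + \<i> * (Im (\<gamma> u) *\<^sub>R Complex (C u) (S u)) * (Im (\<gamma> u) *\<^sub>R Complex (C u) (S u)) / complex_of_real (Im (\<gamma> u))"
    unfolding cov_arc_deriv_def arc_deriv_def sp[OF I(2)] ut[OF I(2)] by simp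
  have cov_Re: "Re (cov_arc_deriv I \<gamma> (unit_tangent I \<gamma>) u) =
      Im (\<gamma> u) * (S u * C u + c1 / v u - 2 * C u * S u)"
    and cov_Im: "Im (cov_arc_deriv I \<gamma> (unit_tangent I \<gamma>) u) =
      Im (\<gamma> u) * (S u * S u + s1 / v u + C u * C u - S u * S u)"
    unfolding cov im using v0 y0 by (simp_all add: field_simps power2_eq_square)
  have "k u = - (S u * C u + c1 / v u - 2 * C u * S u) * S u
      + (S u * S u + s1 / v u + C u * C u - S u * S u) * C u"
    unfolding k_def geodesic_curvature_def hyp_inner_def inner_complex_def un' cov_Re cov_Im
    using y0 by (simp add: field_simps power2_eq_square)
  also have "\<dots> = l / v u * ((C u)\<^sup>2 + (S u)\<^sup>2) + C u * ((C u)\<^sup>2 + (S u)\<^sup>2)"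
    unfolding cl using v0 by (simp add: field_simps power2_eq_square)
  finally have l: "v u * (k u - C u) = l" using v0 by (simp add: one' field_simps)
  then show "(C has_real_derivative - (v u * (k u - C u) * S u)) (at u within I)"
    and "(S has_real_derivative v u * (k u - C u) * C u) (at u within I)"
    unfolding l using c1 s1 cl by (simp_all add: mult.commute)
qed

section \<open>Curves of constant geodesic curvature\<close>

text \<open>The Euclidean curvature \<open>m = (k - C) / y\<close> is constant, and so is the Euclidean centre when
  \<open>m \<noteq> 0\<close>; its height is \<open>k / m\<close>.\<close>

lemma constant_curvature_locus:
  assumes I: "convex I" "I \<noteq> {}" and k: "k > 0"
    and y: "\<And>u. u \<in> I \<Longrightarrow> y u > (0::real)"
    and one: "\<And>u. u \<in> I \<Longrightarrow> (C u)\<^sup>2 + (S u)\<^sup>2 = (1::real)"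
    and dx: "\<And>u. u \<in> I \<Longrightarrow> (x has_real_derivative v u * y u * C u) (at u within I)"
    and dy: "\<And>u. u \<in> I \<Longrightarrow> (y has_real_derivative v u * y u * S u) (at u within I)"
    and dC: "\<And>u. u \<in> I \<Longrightarrow> (C has_real_derivative - (v u * (k - C u) * S u)) (at u within I)"
    and dS: "\<And>u. u \<in> I \<Longrightarrow> (S has_real_derivative v u * (k - C u) * C u) (at u within I)"
  obtains
    (circle) m x0 where "m \<noteq> 0" "k \<ge> 1 \<Longrightarrow> m > 0"
      "\<And>u. u \<in> I \<Longrightarrow> (x u - x0)\<^sup>2 + (y u)\<^sup>2 = 2 * (k / m) * y u + (1 - k\<^sup>2) / m\<^sup>2"
  | (horizontal) h where "k = 1" "h > 0" "\<And>u. u \<in> I \<Longrightarrow> y u = h"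
  | (slanted) x0 a where "k < 1" "a \<noteq> 0" "\<And>u. u \<in> I \<Longrightarrow> x u - x0 = a * y u"
proof -
  have "\<exists>m. \<forall>u\<in>I. (k - C u) / y u = m"
  proof (rule has_field_derivative_zero_constant[OF I(1)])
    fix u assume u: "u \<in> I"
    show "((\<lambda>u. (k - C u) / y u) has_real_derivative 0) (at u within I)"
      using y[OF u] by (auto intro!: derivative_eq_intros dC dy u simp: field_simps)
  qed
  then obtain m where "\<forall>u\<in>I. (k - C u) / y u = m" by blast
  then have m: "k - C u = m * y u" if "u \<in> I" for u
    using that y[OF that] by (auto simp: field_simps)
  obtain u0 where u0: "u0 \<in> I" using I(2) by blast
  have C1: "C u \<le> 1" if "u \<in> I" for u
    using one[OF that] by (metis abs_le_D1 abs_square_le_1 le_add_same_cancel1 zero_le_power2)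
  show thesis
  proof (cases "m = 0")
    case False
    have "\<exists>x0. \<forall>u\<in>I. x u - S u / m = x0"
    proof (rule has_field_derivative_zero_constant[OF I(1)])
      fix u assume u: "u \<in> I"
      show "((\<lambda>u. x u - S u / m) has_real_derivative 0) (at u within I)"
        using False by (auto intro!: derivative_eq_intros dx dS u simp: m[OF u] field_simps)
    qed
    then obtain x0 where x0: "\<forall>u\<in>I. x u - S u / m = x0" by blast
    have "(x u - x0)\<^sup>2 + (y u)\<^sup>2 = 2 * (k / m) * y u + (1 - k\<^sup>2) / m\<^sup>2" if u: "u \<in> I" for u
    proof -
      have "S u = m * (x u - x0)" using x0 u False by (auto simp: field_simps)
      moreover have "C u = k - m * y u" using m[OF u] by simp
      ultimately have "(k - m * y u)\<^sup>2 + (m * (x u - x0))\<^sup>2 = 1" using one[OF u] by simp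
      then have "m\<^sup>2 * ((x u - x0)\<^sup>2 + (y u)\<^sup>2) = 2 * k * m * y u + (1 - k\<^sup>2)" by algebra
      then have "(x u - x0)\<^sup>2 + (y u)\<^sup>2 = (2 * k * m * y u + (1 - k\<^sup>2)) / m\<^sup>2"
        using False by (simp add: nonzero_eq_divide_eq mult.commute)
      then show ?thesis using False by (simp add: add_divide_distrib power2_eq_square)
    qed
    moreover have "m > 0" if "k \<ge> 1"
    proof -
      have "m * y u0 \<ge> 0" using m[OF u0] C1[OF u0] that by linarith
      then show ?thesis using y[OF u0] False by (simp add: zero_le_mult_iff)
    qed
    ultimately show thesis using circle False by blast
  next
    case True
    then have C: "C u = k" if "u \<in> I" for u using m[OF that] by simp
    have "\<exists>s. \<forall>u\<in>I. S u = s"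
    proof (rule has_field_derivative_zero_constant[OF I(1)])
      fix u assume u: "u \<in> I"
      show "(S has_real_derivative 0) (at u within I)" using dS[OF u] C[OF u] by simp
    qed
    then obtain s where s: "\<And>u. u \<in> I \<Longrightarrow> S u = s" by blast
    have ks: "k\<^sup>2 + s\<^sup>2 = 1" using one[OF u0] C[OF u0] s[OF u0] by simp
    show thesis
    proof (cases "s = 0")
      case True
      then have "k = 1" using ks k by (simp add: power2_eq_1_iff)
      moreover have "\<exists>h. \<forall>u\<in>I. y u = h"
      proof (rule has_field_derivative_zero_constant[OF I(1)])
        fix u assume u: "u \<in> I"
        show "(y has_real_derivative 0) (at u within I)" using dy[OF u] s[OF u] True by simp
      qed
      ultimately show thesis using horizontal y u0 by metis
    next
      case False
      then have "s\<^sup>2 > 0" by simp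
      then have "k\<^sup>2 < 1" using ks by linarith
      then have k1: "k < 1" using power_less_imp_less_base[of k 2 1] by simp
      have "\<exists>x0. \<forall>u\<in>I. x u - k / s * y u = x0"
      proof (rule has_field_derivative_zero_constant[OF I(1)])
        fix u assume u: "u \<in> I"
        show "((\<lambda>u. x u - k / s * y u) has_real_derivative 0) (at u within I)"
          using False by (auto intro!: derivative_eq_intros dx dy u simp: C[OF u] s[OF u])
      qed
      then obtain x0 where "\<forall>u\<in>I. x u - k / s * y u = x0" by blast
      then have "x u - x0 = k / s * y u" if "u \<in> I" for u using that by force
      then show thesis using slanted[of "k / s" x0] k1 k False by simp
    qed
  qed
qed

section \<open>Circles, horocycles and equidistant lines\<close>

lemma arcosh_mono: "1 \<le> x \<Longrightarrow> x \<le> y \<Longrightarrow> arcosh x \<le> arcosh (y::real)"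
  by (cases "x = y") (simp, rule less_imp_le, rule arcosh_real_strict_mono, auto)

lemma cmod_diff_Complex_power2: "(cmod (w - Complex a b))\<^sup>2 = (Re w - a)\<^sup>2 + (Im w - b)\<^sup>2"
  by (simp add: cmod_power2)

text \<open>A point at signed distance \<open>d\<close> from the geodesic has \<open>\<sigma> = sinh d\<close>, which is how \<open>\<sigma>\<close> is to be
  read in the next two lemmas.\<close>

lemma hyp_infdist_vertical:
  fixes w :: complex and x :: real
  assumes w: "Im w > 0"
  defines "\<sigma> \<equiv> (Re w - x) / Im w"
  shows "hyp_infdist w {z \<in> hyp_plane. Re z = x} = arcosh (sqrt (1 + \<sigma>\<^sup>2))"
  unfolding hyp_infdist_def
proof (rule cInf_eq_minimum)
  define a y where "a = Re w - x" and "y = Im w"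
  \<comment> \<open>height of the foot of the perpendicular from \<open>w\<close>\<close>
  define h where "h = sqrt (a\<^sup>2 + y\<^sup>2)"
  have y: "y > 0" using w by (simp add: y_def)
  have h: "h > 0" "h\<^sup>2 = a\<^sup>2 + y\<^sup>2" using y by (auto simp: h_def add_nonneg_pos)
  have arg: "1 + (cmod (w - Complex x t))\<^sup>2 / (2 * Im w * t) = (h\<^sup>2 + t\<^sup>2) / (2 * y * t)"
    if "t > 0" for t
    using that y unfolding h(2) cmod_diff_Complex_power2 a_def y_def
    by (simp add: field_simps power2_eq_square)
  have sg: "sqrt (1 + \<sigma>\<^sup>2) = h / y"
    unfolding h_def \<sigma>_def a_def[symmetric] y_def[symmetric] using y
    by (intro real_sqrt_unique) (auto simp: power_divide field_simps)
  show "arcosh (sqrt (1 + \<sigma>\<^sup>2)) \<in> hyp_dist w ` {z \<in> hyp_plane. Re z = x}"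
  proof (rule image_eqI)
    show "Complex x h \<in> {z \<in> hyp_plane. Re z = x}" using h by (simp add: hyp_plane_def)
    have "(h\<^sup>2 + h\<^sup>2) / (2 * y * h) = h / y" using h(1) y by (simp add: field_simps power2_eq_square)
    then show "arcosh (sqrt (1 + \<sigma>\<^sup>2)) = hyp_dist w (Complex x h)"
      unfolding hyp_dist_def complex.sel arg[OF h(1)] sg by simp
  qed
  fix d assume "d \<in> hyp_dist w ` {z \<in> hyp_plane. Re z = x}"
  then obtain t where t: "t > 0" "d = hyp_dist w (Complex x t)"
    by (auto simp: hyp_plane_def)
  have "0 \<le> (h - t)\<^sup>2" by simp
  then have "h / y \<le> (h\<^sup>2 + t\<^sup>2) / (2 * y * t)"
    using t(1) y by (simp add: field_simps power2_eq_square)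
  then show "arcosh (sqrt (1 + \<sigma>\<^sup>2)) \<le> d"
    unfolding t(2) hyp_dist_def complex.sel arg[OF t(1)] sg[symmetric]
    by (rule arcosh_mono[rotated]) simp
qed

lemma hyp_infdist_half_circle:
  fixes w :: complex and x R :: real
  assumes w: "Im w > 0" and R: "R > 0"
  defines "\<sigma> \<equiv> ((cmod (w - complex_of_real x))\<^sup>2 - R\<^sup>2) / (2 * R * Im w)"
  shows "hyp_infdist w {z \<in> hyp_plane. cmod (z - complex_of_real x) = R} = arcosh (sqrt (1 + \<sigma>\<^sup>2))"
  unfolding hyp_infdist_def
proof (rule cInf_eq_minimum)
  define a y where "a = Re w - x" and "y = Im w"
  define M where "M = a\<^sup>2 + y\<^sup>2 + R\<^sup>2"
  have y: "y > 0" using w by (simp add: y_def)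
  have M: "M > 0" unfolding M_def using y R by (simp add: add_nonneg_pos)
  have MR: "M\<^sup>2 - 4 * R\<^sup>2 * a\<^sup>2 > 0"
  proof -
    have "M\<^sup>2 - 4 * R\<^sup>2 * a\<^sup>2 = (a\<^sup>2 + y\<^sup>2 - R\<^sup>2)\<^sup>2 + 4 * R\<^sup>2 * y\<^sup>2" unfolding M_def by algebra
    then show ?thesis using y R by (simp add: add_nonneg_pos)
  qed
  have arg: "1 + (cmod (w - Complex (x + p) t))\<^sup>2 / (2 * Im w * t) = (M - 2 * a * p) / (2 * y * t)"
    if "t > 0" "p\<^sup>2 + t\<^sup>2 = R\<^sup>2" for p t
  proof -
    have "(cmod (w - Complex (x + p) t))\<^sup>2 = (a - p)\<^sup>2 + (y - t)\<^sup>2"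
      by (simp add: cmod_power2 a_def y_def algebra_simps)
    also have "\<dots> = M - 2 * a * p - 2 * y * t" using that(2) unfolding M_def by algebra
    finally show ?thesis using that(1) y by (simp add: y_def[symmetric] field_simps)
  qed
  have sg2: "1 + \<sigma>\<^sup>2 = (M\<^sup>2 - 4 * R\<^sup>2 * a\<^sup>2) / (2 * R * y)\<^sup>2"
  proof -
    have "(cmod (w - complex_of_real x))\<^sup>2 = a\<^sup>2 + y\<^sup>2" by (simp add: cmod_power2 a_def y_def)
    then have "\<sigma>\<^sup>2 = (a\<^sup>2 + y\<^sup>2 - R\<^sup>2)\<^sup>2 / (2 * R * y)\<^sup>2"
      unfolding \<sigma>_def y_def[symmetric] by (simp add: power_divide)
    moreover have "M\<^sup>2 - 4 * R\<^sup>2 * a\<^sup>2 = (2 * R * y)\<^sup>2 + (a\<^sup>2 + y\<^sup>2 - R\<^sup>2)\<^sup>2" unfolding M_def by algebra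
    ultimately show ?thesis using y R by (simp add: add_divide_distrib)
  qed
  have sg: "sqrt (1 + \<sigma>\<^sup>2) = sqrt (M\<^sup>2 - 4 * R\<^sup>2 * a\<^sup>2) / (2 * R * y)"
    unfolding sg2 using y R by (simp add: real_sqrt_divide)
  \<comment> \<open>the foot of the perpendicular from \<open>w\<close>\<close>
  define p t where "p = 2 * R\<^sup>2 * a / M" and "t = R * sqrt (M\<^sup>2 - 4 * R\<^sup>2 * a\<^sup>2) / M"
  have t: "t > 0" using MR R M by (simp add: t_def)
  have "p\<^sup>2 + t\<^sup>2 = ((2 * R\<^sup>2 * a)\<^sup>2 + R\<^sup>2 * (M\<^sup>2 - 4 * R\<^sup>2 * a\<^sup>2)) / M\<^sup>2"
    using MR by (simp add: p_def t_def power_divide power_mult_distrib add_divide_distrib)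
  also have "(2 * R\<^sup>2 * a)\<^sup>2 + R\<^sup>2 * (M\<^sup>2 - 4 * R\<^sup>2 * a\<^sup>2) = R\<^sup>2 * M\<^sup>2" by algebra
  finally have pt: "p\<^sup>2 + t\<^sup>2 = R\<^sup>2" using M by simp
  show "arcosh (sqrt (1 + \<sigma>\<^sup>2)) \<in> hyp_dist w ` {z \<in> hyp_plane. cmod (z - complex_of_real x) = R}"
  proof (rule image_eqI)
    show "Complex (x + p) t \<in> {z \<in> hyp_plane. cmod (z - complex_of_real x) = R}"
      using t pt R by (simp add: hyp_plane_def cmod_def)
    have "(M - 2 * a * p) = (M\<^sup>2 - 4 * R\<^sup>2 * a\<^sup>2) / M"
      using M by (simp add: p_def field_simps power2_eq_square)
    also have "\<dots> = sqrt (M\<^sup>2 - 4 * R\<^sup>2 * a\<^sup>2) * t / R"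
      using MR R by (simp add: t_def)
    finally have e: "M - 2 * a * p = sqrt (M\<^sup>2 - 4 * R\<^sup>2 * a\<^sup>2) * t / R" .
    have "(M - 2 * a * p) / (2 * y * t) = sqrt (M\<^sup>2 - 4 * R\<^sup>2 * a\<^sup>2) / (2 * R * y)"
      unfolding e using t y R by simp
    then show "arcosh (sqrt (1 + \<sigma>\<^sup>2)) = hyp_dist w (Complex (x + p) t)"
      unfolding hyp_dist_def complex.sel arg[OF t pt] sg by simp
  qed
  fix d assume "d \<in> hyp_dist w ` {z \<in> hyp_plane. cmod (z - complex_of_real x) = R}"
  then obtain z where z: "Im z > 0" "cmod (z - complex_of_real x) = R" "d = hyp_dist w z"
    by (auto simp: hyp_plane_def)
  define p t where "p = Re z - x" and "t = Im z"
  have t: "t > 0" and pt: "p\<^sup>2 + t\<^sup>2 = R\<^sup>2"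
    using z cmod_power2[of "z - complex_of_real x"] by (auto simp: p_def t_def)
  have zz: "z = Complex (x + p) t" by (simp add: p_def t_def complex_eq_iff)
  \<comment> \<open>the defect in the claimed lower bound is a square\<close>
  have "R\<^sup>2 * (M - 2 * a * p)\<^sup>2 - t\<^sup>2 * (M\<^sup>2 - 4 * R\<^sup>2 * a\<^sup>2) = (p * M - 2 * R\<^sup>2 * a)\<^sup>2"
    using pt by algebra
  then have "t\<^sup>2 * (M\<^sup>2 - 4 * R\<^sup>2 * a\<^sup>2) \<le> R\<^sup>2 * (M - 2 * a * p)\<^sup>2"
    by (metis diff_ge_0_iff_ge zero_le_power2)
  then have "(M\<^sup>2 - 4 * R\<^sup>2 * a\<^sup>2) / R\<^sup>2 \<le> (M - 2 * a * p)\<^sup>2 / t\<^sup>2"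
    using t R by (simp add: divide_le_eq pos_le_divide_eq mult.commute)
  then have "(M\<^sup>2 - 4 * R\<^sup>2 * a\<^sup>2) / R\<^sup>2 / (2 * y)\<^sup>2 \<le> (M - 2 * a * p)\<^sup>2 / t\<^sup>2 / (2 * y)\<^sup>2"
    by (rule divide_right_mono) simp
  then have "1 + \<sigma>\<^sup>2 \<le> ((M - 2 * a * p) / (2 * y * t))\<^sup>2"
    unfolding sg2 by (simp add: power_divide power_mult_distrib mult_ac)
  moreover have "(M - 2 * a * p) / (2 * y * t) \<ge> 0"
    unfolding arg[OF t pt, symmetric] using t w by simp
  ultimately have "sqrt (1 + \<sigma>\<^sup>2) \<le> (M - 2 * a * p) / (2 * y * t)"
    by (intro real_le_lsqrt) auto
  then show "arcosh (sqrt (1 + \<sigma>\<^sup>2)) \<le> d"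
    unfolding z(3) zz hyp_dist_def complex.sel arg[OF t pt]
    by (rule arcosh_mono[rotated]) simp
qed

text \<open>A connected set that misses the geodesic lies in one component of the complement, that is, on one
  side.\<close>

lemma connected_in_equidistant_line:
  assumes G: "hyp_geodesic G" and K: "connected K" "K \<noteq> {}" "K \<subseteq> hyp_plane - G"
    and d: "d > 0" "\<And>w. w \<in> K \<Longrightarrow> hyp_infdist w G = d"
  shows "\<exists>E. hyp_equidistant_line E \<and> K \<subseteq> E"
proof -
  obtain S where S: "S \<in> components (hyp_plane - G)" "K \<subseteq> S"
    using exists_component_superset[OF K(3) _ K(1)] K(2,3) by blast
  show ?thesis
  proof (intro exI conjI)
    show "hyp_equidistant_line {w \<in> S. hyp_infdist w G = d}"
      unfolding hyp_equidistant_line_def using G S(1) d(1) by blast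
    show "K \<subseteq> {w \<in> S. hyp_infdist w G = d}" using S(2) d(2) by blast
  qed
qed

lemma equidistant_from_vertical:
  assumes "connected K" "K \<noteq> {}" "K \<subseteq> hyp_plane" "a \<noteq> 0"
    and eq: "\<And>w. w \<in> K \<Longrightarrow> Re w - x = a * Im w"
  shows "\<exists>E. hyp_equidistant_line E \<and> K \<subseteq> E"
proof (rule connected_in_equidistant_line[OF _ assms(1,2)])
  show "hyp_geodesic {z \<in> hyp_plane. Re z = x}" unfolding hyp_geodesic_def by blast
  show "K \<subseteq> hyp_plane - {z \<in> hyp_plane. Re z = x}"
    using assms(3,4) eq by (fastforce simp: hyp_plane_def)
  show "arcosh (sqrt (1 + a\<^sup>2)) > 0" using assms(4) by simp
  fix w assume w: "w \<in> K"
  then have "Im w > 0" using assms(3) by (auto simp: hyp_plane_def)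
  then show "hyp_infdist w {z \<in> hyp_plane. Re z = x} = arcosh (sqrt (1 + a\<^sup>2))"
    using eq[OF w] by (simp add: hyp_infdist_vertical)
qed

lemma equidistant_from_half_circle:
  assumes "connected K" "K \<noteq> {}" "K \<subseteq> hyp_plane" "a \<noteq> 0" and R: "R > 0"
    and eq: "\<And>w. w \<in> K \<Longrightarrow> (cmod (w - complex_of_real x))\<^sup>2 - R\<^sup>2 = 2 * a * R * Im w"
  shows "\<exists>E. hyp_equidistant_line E \<and> K \<subseteq> E"
proof (rule connected_in_equidistant_line[OF _ assms(1,2)])
  show "hyp_geodesic {z \<in> hyp_plane. cmod (z - complex_of_real x) = R}"
    unfolding hyp_geodesic_def using R by blast
  show "K \<subseteq> hyp_plane - {z \<in> hyp_plane. cmod (z - complex_of_real x) = R}"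
    using assms(3,4) R eq by (fastforce simp: hyp_plane_def)
  show "arcosh (sqrt (1 + a\<^sup>2)) > 0" using assms(4) by simp
  fix w assume w: "w \<in> K"
  then have y: "Im w > 0" using assms(3) by (auto simp: hyp_plane_def)
  have "((cmod (w - complex_of_real x))\<^sup>2 - R\<^sup>2) / (2 * R * Im w) = a"
    unfolding eq[OF w] using R y by simp
  then show "hyp_infdist w {z \<in> hyp_plane. cmod (z - complex_of_real x) = R} = arcosh (sqrt (1 + a\<^sup>2))"
    by (simp add: hyp_infdist_half_circle[OF y R])
qed

text \<open>The hyperbolic centre lies below the Euclidean one, at height \<open>sqrt (k\<^sup>2 - 1) / m\<close>; the radius is
  the \<open>r\<close> with \<open>coth r = k\<close>.\<close>

lemma in_hyp_circle:
  assumes k: "k > 1" and m: "m > 0" and w: "w \<in> hyp_plane"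
    and eq: "(Re w - x)\<^sup>2 + (Im w)\<^sup>2 = 2 * (k / m) * Im w + (1 - k\<^sup>2) / m\<^sup>2"
  shows "w \<in> hyp_circle (Complex x (sqrt (k\<^sup>2 - 1) / m)) (arcosh (k / sqrt (k\<^sup>2 - 1)))"
proof -
  define h where "h = sqrt (k\<^sup>2 - 1) / m"
  have k2: "k\<^sup>2 > 1" using k by (simp add: one_less_power)
  have h: "h > 0" using k2 m by (simp add: h_def)
  have h2: "h\<^sup>2 = (k\<^sup>2 - 1) / m\<^sup>2" using k2 by (simp add: h_def power_divide)
  have y: "Im w > 0" using w by (simp add: hyp_plane_def)
  have "(cmod (Complex x h - w))\<^sup>2 = ((Re w - x)\<^sup>2 + (Im w)\<^sup>2) - 2 * Im w * h + h\<^sup>2"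
    unfolding norm_minus_commute[of _ w] cmod_diff_Complex_power2
    by (simp add: power2_eq_square algebra_simps)
  also have "\<dots> = 2 * (k / m) * Im w - 2 * Im w * h"
    unfolding eq h2 by (simp add: diff_divide_distrib)
  finally have "1 + (cmod (Complex x h - w))\<^sup>2 / (2 * h * Im w) = k / (m * h)"
    using h y m by (simp add: field_simps)
  also have "\<dots> = k / sqrt (k\<^sup>2 - 1)" using m by (simp add: h_def)
  finally show ?thesis using w by (simp add: hyp_circle_def hyp_dist_def h_def)
qed

lemma in_horocycle:
  assumes m: "m > 0" and w: "w \<in> hyp_plane"
    and eq: "(Re w - x)\<^sup>2 + (Im w)\<^sup>2 = 2 * (1 / m) * Im w"
  shows "cmod (w - Complex x (1 / m)) = 1 / m"
proof -
  have "(cmod (w - Complex x (1 / m)))\<^sup>2 = (1 / m)\<^sup>2"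
    using eq unfolding cmod_diff_Complex_power2 by (simp add: power2_eq_square algebra_simps)
  then show ?thesis using m by (simp add: power2_eq_iff_nonneg)
qed

section \<open>Curve shortening flows with separated pressure\<close>

lemma smooth_family_smooth:
  fixes r :: "'a::real_normed_vector \<Rightarrow> real"
  assumes r: "bounded_linear r"
    and cont: "\<And>m n. continuous_on (J \<times> I) (\<lambda>(t, u). D m n t u)"
    and Dt: "\<And>m n t u. t \<in> J \<Longrightarrow> u \<in> I \<Longrightarrow>
      ((\<lambda>t'. D m n t' u) has_vector_derivative D (Suc m) n t u) (at t within J)"
    and Du: "\<And>m n t u. t \<in> J \<Longrightarrow> u \<in> I \<Longrightarrow>
      ((\<lambda>u'. D m n t u') has_vector_derivative D m (Suc n) t u) (at u within I)"
  shows "smooth (interior J) (interior I) (\<lambda>t u. r (D m n t u))"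
    and "\<And>t u. t \<in> interior J \<Longrightarrow> u \<in> interior I \<Longrightarrow> dt (\<lambda>t u. r (D m n t u)) t u = r (D (Suc m) n t u)"
    and "\<And>t u. t \<in> interior J \<Longrightarrow> u \<in> interior I \<Longrightarrow> du (\<lambda>t u. r (D m n t u)) t u = r (D m (Suc n) t u)"
proof -
  have t: "((\<lambda>t'. r (D m n t' u)) has_real_derivative r (D (Suc m) n t u)) (at t)"
    if "t \<in> interior J" "u \<in> interior I" for m n t u
  proof -
    have "t \<in> J" "u \<in> I" using that interior_subset by blast+
    from bounded_linear.has_vector_derivative[OF r Dt[OF this]] show ?thesis
      using at_within_interior[OF that(1)] by (simp add: has_real_derivative_iff_has_vector_derivative)
  qed
  have u: "((\<lambda>u'. r (D m n t u')) has_real_derivative r (D m (Suc n) t u)) (at u)"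
    if "t \<in> interior J" "u \<in> interior I" for m n t u
  proof -
    have "t \<in> J" "u \<in> I" using that interior_subset by blast+
    from bounded_linear.has_vector_derivative[OF r Du[OF this]] show ?thesis
      using at_within_interior[OF that(2)] by (simp add: has_real_derivative_iff_has_vector_derivative)
  qed
  show "\<And>t u. t \<in> interior J \<Longrightarrow> u \<in> interior I \<Longrightarrow> dt (\<lambda>t u. r (D m n t u)) t u = r (D (Suc m) n t u)"
    by (rule dt_eqI) (rule t)
  show "\<And>t u. t \<in> interior J \<Longrightarrow> u \<in> interior I \<Longrightarrow> du (\<lambda>t u. r (D m n t u)) t u = r (D m (Suc n) t u)"
    by (rule du_eqI) (rule u)
  have c: "continuous_on (interior J \<times> interior I) (\<lambda>(t, u). r (D m n t u))" for m n
  proof -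
    have "interior J \<times> interior I \<subseteq> J \<times> I" using interior_subset by blast
    from bounded_linear.continuous_on[OF r continuous_on_subset[OF cont this]] show ?thesis
      by (simp add: split_beta)
  qed
  have "ck_on k (interior J) (interior I) (\<lambda>t u. r (D m n t u))" for k
  proof (induction k arbitrary: m n)
    case 0 then show ?case using c by simp
  next
    case (Suc k)
    show ?case by (rule ck_onI[OF c t u Suc Suc])
  qed
  then show "smooth (interior J) (interior I) (\<lambda>t u. r (D m n t u))" by (simp add: smooth_def)
qed

lemma smooth_familyE:
  assumes "smooth_family J I f"
  obtains D where "f = D 0 0" and "\<And>m n. continuous_on (J \<times> I) (\<lambda>(t, u). D m n t u)"
    and "\<And>m n t u. t \<in> J \<Longrightarrow> u \<in> I \<Longrightarrow>
      ((\<lambda>t'. D m n t' u) has_vector_derivative D (Suc m) n t u) (at t within J)"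
    and "\<And>m n t u. t \<in> J \<Longrightarrow> u \<in> I \<Longrightarrow>
      ((\<lambda>u'. D m n t u') has_vector_derivative D m (Suc n) t u) (at u within I)"
proof -
  obtain D where D: "D 0 0 = f" "\<forall>m n. continuous_on (J \<times> I) (\<lambda>(t, u). D m n t u) \<and>
           (\<forall>t\<in>J. \<forall>u\<in>I.
              ((\<lambda>t'. D m n t' u) has_vector_derivative D (Suc m) n t u) (at t within J) \<and>
              ((\<lambda>u'. D m n t u') has_vector_derivative D m (Suc n) t u) (at u within I))"
    using assms unfolding smooth_family_def by (elim exE conjE)
  show thesis
  proof (rule that[of D])
    fix m n
    note Dmn = D(2)[rule_format, of m n]
    show "continuous_on (J \<times> I) (\<lambda>(t, u). D m n t u)" using Dmn by (rule conjunct1)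
    fix t u assume "t \<in> J" "u \<in> I"
    with Dmn show "((\<lambda>t'. D m n t' u) has_vector_derivative D (Suc m) n t u) (at t within J)"
      "((\<lambda>u'. D m n t u') has_vector_derivative D m (Suc n) t u) (at u within I)" by simp_all
  qed (simp add: D(1))
qed

lemma hyp_inner_frame:
  "Im z > 0 \<Longrightarrow> hyp_inner z a (Im z *\<^sub>R Complex c s) = (Re a * c + Im a * s) / Im z"
  by (simp add: hyp_inner_def inner_complex_def power2_eq_square divide_simps)
    (simp add: algebra_simps)

lemma interval_between_interior:
  fixes I :: "real set"
  assumes "is_interval I" "a \<in> I" "b \<in> I" "a < z" "z < b"
  shows "z \<in> interior I"
proof -
  have "{a<..<b} \<subseteq> I"
    using mem_is_interval_1_I[OF assms(1-3)] by auto
  then have "{a<..<b} \<subseteq> interior I" by (intro interior_maximal) auto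
  then show ?thesis using assms by auto
qed

lemma interval_interior_dense:
  fixes I :: "real set"
  assumes "is_interval I" "a \<in> I" "I \<noteq> {a}"
  shows "interior I \<noteq> {}" and "I \<subseteq> closure (interior I)"
proof -
  obtain b where b: "b \<in> I" "b \<noteq> a" using assms(2,3) by blast
  have "(a + b) / 2 \<in> interior I"
    by (rule interval_between_interior[OF assms(1), of "min a b" "max a b"]) (use b assms in \<open>auto simp: min_def max_def\<close>)
  then show ne: "interior I \<noteq> {}" by blast
  have "closure (interior I) = closure I"
    using assms(1) is_interval_convex by (intro convex_closure_interior ne) blast
  then show "I \<subseteq> closure (interior I)" using closure_subset by metis
qed

lemma continuous_constant_dense:
  fixes f :: "'a::topological_space \<Rightarrow> real"
  assumes "continuous_on S f" "T \<subseteq> S" "S \<subseteq> closure T" "\<And>x. x \<in> T \<Longrightarrow> f x = a" "x \<in> S"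
  shows "f x = a"
proof -
  have "closedin (top_of_set S) {x \<in> S. f x = a}"
    by (rule continuous_closedin_preimage_constant[OF assms(1)])
  then obtain K where K: "closed K" "{x \<in> S. f x = a} = S \<inter> K" by (auto simp: closedin_closed)
  then have "T \<subseteq> K" using assms(2,4) by blast
  then have "closure T \<subseteq> K" using K(1) by (rule closure_minimal)
  then show ?thesis using assms(3,5) K(2) by blast
qed

lemma strictly_increasing_on_interval:
  fixes f :: "real \<Rightarrow> real"
  assumes I: "is_interval I"
    and d: "\<And>u. u \<in> I \<Longrightarrow> (f has_real_derivative d u) (at u within I)" "\<And>u. u \<in> I \<Longrightarrow> d u > 0"
    and xy: "x \<in> I" "y \<in> I" "x < y"
  shows "f x < f y"
proof (rule DERIV_pos_imp_increasing_open[OF xy(3)])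
  fix z assume z: "x < z" "z < y"
  have zi: "z \<in> interior I" by (rule interval_between_interior[OF I xy(1,2) z])
  then show "\<exists>y. (f has_real_derivative y) (at z) \<and> y > 0"
    using d[of z] interior_subset[of I] at_within_interior[OF zi] by (metis subsetD)
next
  have "{x..y} \<subseteq> I" using mem_is_interval_1_I[OF I xy(1,2)] by auto
  moreover have "continuous_on I f" by (rule DERIV_continuous_on) (rule d(1))
  ultimately show "continuous_on {x..y} f" by (metis continuous_on_subset)
qed

text \<open>The smooth calculus applies in the interior of the parameter domain.  Up to its boundary only the
  continuity of the curvature is asserted; it holds because the curvature is the normal velocity,
  which involves first derivatives only.\<close>

lemma csf_separated_curvature_constant:
  fixes J I :: "real set" and \<gamma> :: "real \<Rightarrow> real \<Rightarrow> complex"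
  assumes J: "is_interval J" "0 \<in> J" "J \<noteq> {0}"
    and I: "is_interval I" "u0 \<in> I" "I \<noteq> {u0}"
    and csf: "csf_solution J I \<gamma>" and convex: "convex_family J I \<gamma>"
    and gr: "grayson_angle J I \<gamma> u0 \<phi> \<rho>"
    and sep: "\<forall>t\<in>J. \<forall>x\<in>\<phi> t ` I. pressure I \<gamma> \<phi> t x = a t + b x"
  defines "k \<equiv> \<lambda>t u. geodesic_curvature I (\<gamma> t) u"
  shows "continuous_on (J \<times> I) (\<lambda>(t, u). k t u)"
    and "\<And>t u. t \<in> interior J \<Longrightarrow> u \<in> interior I \<Longrightarrow> (k t has_real_derivative 0) (at u)"
    and "\<And>t u. t \<in> interior J \<Longrightarrow> u \<in> interior I \<Longrightarrow>
      ((\<lambda>t. k t u) has_real_derivative (k t u) ^ 3 - k t u) (at t)"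
proof -
  define A B where "A = interior J" and "B = interior I"
  have AB: "open A" "open B" "A \<subseteq> J" "B \<subseteq> I" by (auto simp: A_def B_def interior_subset)
  have cB: "convex B" using I(1) by (simp add: B_def is_interval_convex)
  have nJ: "J \<noteq> {t}" and nI: "I \<noteq> {u}" for t u using J I by auto
  from csf have "smooth_family J I \<gamma>" by (simp add: csf_solution_def)
  then obtain D where D0: "\<gamma> = D 0 0" and D: "\<And>m n. continuous_on (J \<times> I) (\<lambda>(t, u). D m n t u)"
    "\<And>m n t u. t \<in> J \<Longrightarrow> u \<in> I \<Longrightarrow>
      ((\<lambda>t'. D m n t' u) has_vector_derivative D (Suc m) n t u) (at t within J)"
    "\<And>m n t u. t \<in> J \<Longrightarrow> u \<in> I \<Longrightarrow>
      ((\<lambda>u'. D m n t u') has_vector_derivative D m (Suc n) t u) (at u within I)"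
    by (rule smooth_familyE) blast
  from gr have "smooth_family J I \<phi>" by (simp add: grayson_angle_def)
  then obtain P where P0: "\<phi> = P 0 0" and P: "\<And>m n. continuous_on (J \<times> I) (\<lambda>(t, u). P m n t u)"
    "\<And>m n t u. t \<in> J \<Longrightarrow> u \<in> I \<Longrightarrow>
      ((\<lambda>t'. P m n t' u) has_vector_derivative P (Suc m) n t u) (at t within J)"
    "\<And>m n t u. t \<in> J \<Longrightarrow> u \<in> I \<Longrightarrow>
      ((\<lambda>u'. P m n t u') has_vector_derivative P m (Suc n) t u) (at u within I)"
    by (rule smooth_familyE) blast
  define E W where "E = D 0 1" and "W = D 1 0"
  define x y n where "x = (\<lambda>t u. Re (\<gamma> t u))" and "y = (\<lambda>t u. Im (\<gamma> t u))" and "n = (\<lambda>t u. cmod (E t u))"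
  define v C S where "v = (\<lambda>t u. n t u / y t u)" and "C = (\<lambda>t u. Re (E t u) / n t u)"
    and "S = (\<lambda>t u. Im (E t u) / n t u)"
  define w where "w = (\<lambda>t u. (Re (W t u) * C t u + Im (W t u) * S t u) / y t u)"
  have nbI: "at u within I \<noteq> bot" if "u \<in> I" for u by (rule at_within_interval_neq_bot[OF I(1) that nI])
  have nbJ: "at t within J \<noteq> bot" if "t \<in> J" for t by (rule at_within_interval_neq_bot[OF J(1) that nJ])
  have Im_y: "Im (\<gamma> t u) = y t u" for t u by (simp add: y_def)
  have csf': "\<gamma> t u \<in> hyp_plane" "vector_derivative (\<gamma> t) (at u within I) \<noteq> 0"
    "hyp_inner (\<gamma> t u) (vector_derivative (\<lambda>t'. \<gamma> t' u) (at t within J)) (unit_normal I (\<gamma> t) u) = k t u"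
    if "t \<in> J" "u \<in> I" for t u
    using csf that unfolding csf_solution_def k_def by blast+
  have y0: "y t u > 0" if "t \<in> J" "u \<in> I" for t u
    using csf'(1)[OF that] by (simp add: hyp_plane_def y_def)
  have d1: "(\<gamma> t has_vector_derivative E t u) (at u within I)" if "t \<in> J" "u \<in> I" for t u
    using D(3)[OF that, of 0 0] by (simp add: D0 E_def)
  have d2: "(E t has_vector_derivative D 0 2 t u) (at u within I)" if "t \<in> J" "u \<in> I" for t u
    using D(3)[OF that, of 0 1] by (simp add: E_def numeral_2_eq_2)
  have vdE: "vector_derivative (\<gamma> t) (at u within I) = E t u" if "t \<in> J" "u \<in> I" for t u
    by (rule vector_derivative_within[OF nbI d1]) (use that in auto)
  have vdW: "vector_derivative (\<lambda>t'. \<gamma> t' u) (at t within J) = W t u" if "t \<in> J" "u \<in> I" for t u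
    by (rule vector_derivative_within[OF nbJ]) (use that D(2)[OF that, of 0 0] in \<open>auto simp: D0 W_def\<close>)
  have E0: "E t u \<noteq> 0" if "t \<in> J" "u \<in> I" for t u
    using csf'(2)[OF that] vdE[OF that] by simp
  have n0: "n t u > 0" if "t \<in> J" "u \<in> I" for t u using E0[OF that] by (simp add: n_def)
  have k0: "k t u > 0" if "t \<in> J" "u \<in> I" for t u
    using convex that by (simp add: convex_family_def k_def)
  have frame: "curve_speed I (\<gamma> t) u = v t u"
    "unit_tangent I (\<gamma> t) u = y t u *\<^sub>R Complex (C t u) (S t u)"
    "unit_normal I (\<gamma> t) u = y t u *\<^sub>R Complex (- S t u) (C t u)"
    "(C t u)\<^sup>2 + (S t u)\<^sup>2 = 1" "v t u > 0"
    "Re (E t u) = v t u * y t u * C t u" "Im (E t u) = v t u * y t u * S t u"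
    "(C t has_real_derivative - (v t u * (k t u - C t u) * S t u)) (at u within I)"
    "(S t has_real_derivative v t u * (k t u - C t u) * C t u) (at u within I)"
    if "t \<in> J" "u \<in> I" for t u
    using euclidean_frame[OF I(1) that(2) nI d1[OF that(1)] d2[OF that(1)] E0[OF that(1)]
        y0[OF that(1), unfolded y_def]]
    unfolding v_def C_def S_def unfolding n_def y_def k_def by simp_all
  have k: "k t u = (Im (W t u) * C t u - Re (W t u) * S t u) / y t u" if "t \<in> J" "u \<in> I" for t u
  proof -
    have "k t u = hyp_inner (\<gamma> t u) (W t u) (unit_normal I (\<gamma> t) u)"
      using csf'(3)[OF that] vdW[OF that] by simp
    then show ?thesis using y0[OF that] hyp_inner_frame[of "\<gamma> t u" "W t u" "- S t u" "C t u"]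
      by (simp add: frame(3)[OF that] Im_y)
  qed
  have yn0: "y t u \<noteq> 0" if "t \<in> J" "u \<in> I" for t u using y0[OF that] by simp
  note cD = D(1)[unfolded continuous_on_rect]
  have "continuous_on (J \<times> I) (\<lambda>z. (\<lambda>t u. (Im (W t u) * C t u - Re (W t u) * S t u) / y t u) (fst z) (snd z))"
    unfolding C_def S_def n_def y_def E_def W_def D0
    by (intro continuous_intros cD) (use E0 yn0 in \<open>auto simp: E_def y_def D0\<close>)
  then show contk: "continuous_on (J \<times> I) (\<lambda>(t, u). k t u)"
    unfolding continuous_on_rect by (rule continuous_on_eq) (auto simp: k)
  note smooth_D = smooth_family_smooth[where D=D and J=J and I=I, folded A_def B_def]
  have smD: "smooth A B (\<lambda>t u. r (D m l t u))" if "bounded_linear r" for r :: "complex \<Rightarrow> real" and m l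
    by (rule smooth_D(1)[OF that]; rule D; assumption)
  have dtD: "dt (\<lambda>t u. r (D m l t u)) t u = r (D (Suc m) l t u)"
    if "bounded_linear r" "t \<in> A" "u \<in> B" for r :: "complex \<Rightarrow> real" and m l t u
    by (rule smooth_D(2)[OF that(1) _ _ _ that(2,3)]; rule D; assumption)
  have duD: "du (\<lambda>t u. r (D m l t u)) t u = r (D m (Suc l) t u)"
    if "bounded_linear r" "t \<in> A" "u \<in> B" for r :: "complex \<Rightarrow> real" and m l t u
    by (rule smooth_D(3)[OF that(1) _ _ _ that(2,3)]; rule D; assumption)
  note smooth_P = smooth_family_smooth[where r="\<lambda>x. x" and D=P and J=J and I=I, folded A_def B_def]
  have smP: "smooth A B \<phi>" unfolding P0
    by (rule smooth_P(1)[OF bounded_linear_ident]; rule P; assumption)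
  have dtP: "dt \<phi> t u = P 1 0 t u" if "t \<in> A" "u \<in> B" for t u unfolding P0 One_nat_def
    by (rule smooth_P(2)[OF bounded_linear_ident _ _ _ that]; rule P; assumption)
  have duP: "du \<phi> t u = P 0 1 t u" if "t \<in> A" "u \<in> B" for t u unfolding P0 One_nat_def
    by (rule smooth_P(3)[OF bounded_linear_ident _ _ _ that]; rule P; assumption)
  have sm0: "smooth A B (\<lambda>t u. Re (D m l t u))" "smooth A B (\<lambda>t u. Im (D m l t u))" for m l
    using smD[OF bounded_linear_Re] smD[OF bounded_linear_Im] by blast+
  have pos: "v t u > 0" "y t u > 0" "k t u > 0" "n t u > 0" if "t \<in> A" "u \<in> B" for t u
    using frame(5) y0 k0 n0 that AB by blast+
  have sx: "smooth A B x" "smooth A B y" unfolding x_def y_def D0 by (rule sm0)+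
  have sn: "smooth A B n" unfolding n_def cmod_def E_def
  proof (intro smooth_sqrt smooth_add smooth_power sm0 AB)
    fix t u assume "t \<in> A" "u \<in> B"
    then have "E t u \<noteq> 0" using E0 AB by blast
    then show "0 < (Re (D 0 1 t u))\<^sup>2 + (Im (D 0 1 t u))\<^sup>2"
      by (simp add: E_def complex_eq_iff sum_power2_gt_zero_iff)
  qed
  have sv: "smooth A B v" unfolding v_def by (intro smooth_divide AB sn sx pos)
  have sC: "smooth A B C" unfolding C_def E_def by (intro smooth_divide AB sn sm0 pos)
  have sS: "smooth A B S" unfolding S_def E_def by (intro smooth_divide AB sn sm0 pos)
  have sw: "smooth A B w" unfolding w_def W_def
    by (intro smooth_divide smooth_add smooth_mult AB sC sS sx sm0 pos)
  have sk: "smooth A B k"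
  proof (rule smooth_cong[OF AB(1,2)])
    show "smooth A B (\<lambda>t u. (Im (W t u) * C t u - Re (W t u) * S t u) / y t u)"
      unfolding W_def by (intro smooth_divide smooth_diff smooth_mult AB sC sS sx sm0 pos)
  qed (use k[symmetric] AB in blast)
  define q where "q = (\<lambda>t u. du k t u / v t u)"
  define h where "h = (\<lambda>t u. (w t u + q t u / k t u) / v t u)"
  have duI: "du f t u = d" if "(f t has_real_derivative d) (at u within I)" "u \<in> B" for f t u d
    by (rule du_eqI) (use that at_within_interior[of u I] in \<open>simp add: B_def\<close>)
  have evol: "dt v t u = du w t u - v t u * (k t u)\<^sup>2"
    "v t u * dt k t u = du q t u + w t u * du k t u + v t u * ((k t u) ^ 3 - k t u)"
    if tu: "t \<in> A" "u \<in> B" for t u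
  proof -
    have sub: "t \<in> J" "u \<in> I" if "t \<in> A" "u \<in> B" for t u using that AB by auto
    have 1: "du x t u = v t u * y t u * C t u" "du y t u = v t u * y t u * S t u" if "t \<in> A" "u \<in> B" for t u
      using duD[OF bounded_linear_Re that, of 0 0] duD[OF bounded_linear_Im that, of 0 0]
        frame(6,7)[OF sub[OF that]] by (simp_all add: x_def y_def D0 E_def)
    have 2: "dt x t u = y t u * (w t u * C t u - k t u * S t u)"
        "dt y t u = y t u * (w t u * S t u + k t u * C t u)" if "t \<in> A" "u \<in> B" for t u
    proof -
      have d: "dt x t u = Re (W t u)" "dt y t u = Im (W t u)"
        using dtD[OF bounded_linear_Re that, of 0 0] dtD[OF bounded_linear_Im that, of 0 0]
        by (simp_all add: x_def y_def D0 W_def)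
      have e: "y t u * w t u = Re (W t u) * C t u + Im (W t u) * S t u"
        "y t u * k t u = Im (W t u) * C t u - Re (W t u) * S t u"
        using pos(2)[OF that] k[OF sub[OF that]] by (simp_all add: w_def)
      have "y t u * (w t u * C t u - k t u * S t u) = Re (W t u) * ((C t u)\<^sup>2 + (S t u)\<^sup>2)"
        using e by algebra
      then show "dt x t u = y t u * (w t u * C t u - k t u * S t u)"
        by (simp add: d frame(4)[OF sub[OF that]])
      have "y t u * (w t u * S t u + k t u * C t u) = Im (W t u) * ((C t u)\<^sup>2 + (S t u)\<^sup>2)"
        using e by algebra
      then show "dt y t u = y t u * (w t u * S t u + k t u * C t u)"
        by (simp add: d frame(4)[OF sub[OF that]])
    qed
    show "dt v t u = du w t u - v t u * (k t u)\<^sup>2"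
      "v t u * dt k t u = du q t u + w t u * du k t u + v t u * ((k t u) ^ 3 - k t u)"
      unfolding q_def
      by (rule curvature_evolution[OF AB(1,2) sx sv sC sS sk sw pos(1,2) 1 frame(4)[OF sub]
            duI[OF frame(8)[OF sub]] duI[OF frame(9)[OF sub]] 2 tu]; assumption)+
  qed
  have gr': "\<rho> t u > 0" "\<rho> t u * arc_deriv I (\<gamma> t) (\<phi> t) u = k t u"
    "\<rho> t u * normal_time_deriv J I \<gamma> \<phi> t u = arc_deriv I (\<gamma> t) (k t) u" if "t \<in> J" "u \<in> I" for t u
    using gr that by (auto simp: grayson_angle_def k_def)
  have dphi: "(\<phi> t has_real_derivative P 0 1 t u) (at u within I)" if "t \<in> J" "u \<in> I" for t u
    using P(3)[OF that, of 0 0] by (simp add: P0 has_real_derivative_iff_has_vector_derivative)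
  have vdphi: "vector_derivative (\<phi> t) (at u within I) = P 0 1 t u" if "t \<in> J" "u \<in> I" for t u
    by (rule vector_derivative_within[OF nbI[OF that(2)]])
      (use dphi[OF that] in \<open>simp add: has_real_derivative_iff_has_vector_derivative\<close>)
  have rho: "\<rho> t u * P 0 1 t u = v t u * k t u" if "t \<in> J" "u \<in> I" for t u
    using gr'(2)[OF that] frame(5)[OF that]
    by (simp add: arc_deriv_def vdphi[OF that] frame(1)[OF that] field_simps)
  have phipos: "P 0 1 t u > 0" if "t \<in> J" "u \<in> I" for t u
    using rho[OF that] gr'(1)[OF that] frame(5)[OF that] k0[OF that]
    by (metis mult_pos_pos zero_less_mult_pos)
  have sep': "(k t u)\<^sup>2 = a t + b (\<phi> t u)" if tu: "t \<in> J" "u \<in> I" for t u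
  proof -
    have "inj_on (\<phi> t) I"
    proof (rule linorder_inj_onI')
      fix i j assume "i \<in> I" "j \<in> I" "i < j"
      then show "\<phi> t i \<noteq> \<phi> t j"
        using strictly_increasing_on_interval[OF I(1) dphi phipos] tu(1) by force
    qed
    then have "pressure I \<gamma> \<phi> t (\<phi> t u) = (k t u)\<^sup>2"
      using tu by (simp add: pressure_def the_inv_into_f_f k_def)
    then show ?thesis using sep tu by auto
  qed
  \<comment> \<open>both equations for the angle contain \<open>\<rho>\<close>; eliminating it leaves the direction of the level sets\<close>
  have level: "dt \<phi> t u = h t u * du \<phi> t u" if tu: "t \<in> A" "u \<in> B" for t u
  proof -
    have tu': "t \<in> J" "u \<in> I" using tu AB by auto
    have "vector_derivative (\<lambda>t'. \<phi> t' u) (at t within J) = P 1 0 t u"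
      by (rule vector_derivative_within[OF nbJ[OF tu'(1)]]) (use P(2)[OF tu', of 0 0] in \<open>simp add: P0\<close>)
    moreover have "hyp_inner (\<gamma> t u) (W t u) (unit_tangent I (\<gamma> t) u) = w t u"
      using y0[OF tu'] hyp_inner_frame[of "\<gamma> t u" "W t u" "C t u" "S t u"]
      by (simp add: frame(2)[OF tu'] Im_y w_def)
    moreover have "vector_derivative (k t) (at u within I) = du k t u"
    proof (rule vector_derivative_within[OF nbI[OF tu'(2)]])
      show "(k t has_vector_derivative du k t u) (at u within I)"
        using smooth_has_du[OF sk tu]
        by (simp add: has_real_derivative_iff_has_vector_derivative has_vector_derivative_at_within)
    qed
    ultimately have "\<rho> t u * (P 1 0 t u - w t u * (P 0 1 t u / v t u)) = q t u"
      using gr'(3)[OF tu'] by (simp add: normal_time_deriv_def arc_deriv_def vdW[OF tu']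
          vdphi[OF tu'] frame(1)[OF tu'] q_def)
    then have "k t u * v t u * (P 1 0 t u - w t u * (P 0 1 t u / v t u)) = q t u * P 0 1 t u"
      using rho[OF tu'] by (metis mult.commute mult.left_commute)
    then have "P 1 0 t u - w t u * (P 0 1 t u / v t u) = q t u * P 0 1 t u / (k t u * v t u)"
      using pos(1,3)[OF tu] by (simp add: nonzero_eq_divide_eq mult.commute)
    then show ?thesis unfolding dtP[OF tu] duP[OF tu] h_def
      by (simp add: add_divide_distrib algebra_simps)
  qed
  have phi_pos: "du \<phi> t u > 0" and sepAB: "(k t u)\<^sup>2 = a t + b (\<phi> t u)"
    if "t \<in> A" "u \<in> B" for t u
    using duP[OF that] phipos sep' that AB by (metis subsetD)+
  have p: "smooth A B (\<lambda>t u. (k t u)\<^sup>2)" by (intro smooth_power sk)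
  have Lc: "dt (\<lambda>t u. (k t u)\<^sup>2) t u1 - h t u1 * du (\<lambda>t u. (k t u)\<^sup>2) t u1 =
      dt (\<lambda>t u. (k t u)\<^sup>2) t u2 - h t u2 * du (\<lambda>t u. (k t u)\<^sup>2) t u2"
    if "t \<in> A" "u1 \<in> B" "u2 \<in> B" for t u1 u2
    by (rule separated_level_derivative[OF AB(1,2) cB smP p phi_pos level sepAB that])
  have ku: "du k t u = 0" if tu: "t \<in> A" "u \<in> B" for t u
  proof (rule separated_curvature_constant[OF AB(1,2) sv sk sw pos(1,3) evol q_def h_def _ tu])
    fix t u assume tu: "t \<in> A" "u \<in> B"
    have "du (\<lambda>t u. dt (\<lambda>t u. (k t u)\<^sup>2) t u - h t u * du (\<lambda>t u. (k t u)\<^sup>2) t u) t u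
      = du (\<lambda>_ _. dt (\<lambda>t u. (k t u)\<^sup>2) t u - h t u * du (\<lambda>t u. (k t u)\<^sup>2) t u) t u"
      by (rule du_cong[OF AB(2) tu(2)]) (rule Lc[OF tu(1) _ tu(2)])
    then show "du (\<lambda>t u. dt (\<lambda>t u. (k t u)\<^sup>2) t u - h t u * du (\<lambda>t u. (k t u)\<^sup>2) t u) t u = 0"
      by (simp add: du_def)
  qed
  show "(k t has_real_derivative 0) (at u)" if "t \<in> interior J" "u \<in> interior I" for t u
    using smooth_has_du[OF sk, of t u] ku that by (simp add: A_def B_def)
  show "((\<lambda>t. k t u) has_real_derivative (k t u) ^ 3 - k t u) (at t)"
    if "t \<in> interior J" "u \<in> interior I" for t u
  proof -
    have tu: "t \<in> A" "u \<in> B" using that by (auto simp: A_def B_def)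
    have "du q t u = 0" by (rule du_zero[OF AB(2) tu(2)]) (use ku tu in \<open>simp add: q_def\<close>)
    then have "dt k t u = (k t u) ^ 3 - k t u"
      using evol(2)[OF tu] ku[OF tu] pos(1)[OF tu] by simp
    then show ?thesis using smooth_has_dt[OF sk tu] by simp
  qed
qed

text \<open>The quantity \<open>1 - 1 / K\<^sup>2\<close> grows like \<open>exp (2t)\<close>: its derivative \<open>2 K' / K\<^sup>3\<close> is twice itself.\<close>

lemma curvature_time_law:
  fixes K :: "real \<Rightarrow> real"
  assumes J: "is_interval J" "0 \<in> J"
    and cont: "continuous_on J K" and pos: "\<And>t. t \<in> J \<Longrightarrow> K t > 0"
    and ode: "\<And>t. t \<in> interior J \<Longrightarrow> (K has_real_derivative (K t) ^ 3 - K t) (at t)"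
  obtains c where "\<And>t. t \<in> J \<Longrightarrow> 1 - 1 / (K t)\<^sup>2 = c * exp (2 * t)"
proof -
  define Z where "Z = (\<lambda>t. (1 - 1 / (K t)\<^sup>2) * exp (- 2 * t))"
  have contZ: "continuous_on J Z"
    unfolding Z_def using pos by (intro continuous_intros cont) force
  \<comment> \<open>the differential equation holds inside \<open>J\<close> only, so end points are reached by continuity\<close>
  have eq: "Z s = Z t" if st: "s \<in> J" "t \<in> J" "s < t" for s t
  proof -
    have sub: "{s..t} \<subseteq> J" using mem_is_interval_1_I[OF J(1) st(1,2)] by auto
    have "Z t = Z s"
    proof (rule DERIV_isconst_end[OF st(3) continuous_on_subset[OF contZ sub]])
      fix z assume z: "s < z" "z < t"
      have zi: "z \<in> interior J" by (rule interval_between_interior[OF J(1) st(1,2) z])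
      then have Kz: "K z > 0" using pos interior_subset by blast
      show "(Z has_real_derivative 0) (at z)"
        unfolding Z_def using Kz
        by (auto intro!: derivative_eq_intros ode[OF zi] simp: field_simps power2_eq_square power3_eq_cube)
    qed
    then show ?thesis by simp
  qed
  have "Z t = Z 0" if "t \<in> J" for t
    using eq that J(2) by (metis linorder_cases)
  moreover have "1 - 1 / (K t)\<^sup>2 = Z t * exp (2 * t)" for t
    by (simp add: Z_def mult.assoc flip: exp_add)
  ultimately have "1 - 1 / (K t)\<^sup>2 = Z 0 * exp (2 * t)" if "t \<in> J" for t
    using that by metis
  then show thesis by (rule that)
qed

theorem theorem4p3:
  fixes J I :: "real set" and u0 :: real
    and \<gamma> :: "real \<Rightarrow> real \<Rightarrow> complex"
    and \<phi> \<rho> :: "real \<Rightarrow> real \<Rightarrow> real"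
    and a b :: "real \<Rightarrow> real"
  assumes "is_interval J" and "0 \<in> J" and "J \<noteq> {0}"
    and "is_interval I" and "u0 \<in> I" and "I \<noteq> {u0}"
    and "csf_solution J I \<gamma>" and "convex_family J I \<gamma>"
    and "grayson_angle J I \<gamma> u0 \<phi> \<rho>"
    and "\<forall>t\<in>J. \<forall>x\<in>\<phi> t ` I. pressure I \<gamma> \<phi> t x = a t + b x"
  shows "shrinking_circles J I \<gamma> \<or> horocycle_family J I \<gamma> \<or>
         equidistant_family J I \<gamma> \<or> csf_soliton J I \<gamma>"
proof -
  note J = assms(1-3) and I = assms(4-6)
  define k where "k = (\<lambda>t u. geodesic_curvature I (\<gamma> t) u)"
  have curv: "continuous_on (J \<times> I) (\<lambda>(t, u). k t u)"
    "\<And>t u. t \<in> interior J \<Longrightarrow> u \<in> interior I \<Longrightarrow> (k t has_real_derivative 0) (at u)"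
    "\<And>t u. t \<in> interior J \<Longrightarrow> u \<in> interior I \<Longrightarrow>
      ((\<lambda>t. k t u) has_real_derivative (k t u) ^ 3 - k t u) (at t)"
    unfolding k_def by (rule csf_separated_curvature_constant[OF assms]; assumption)+
  have nI: "I \<noteq> {u}" for u using I by auto
  have cI: "convex I" using I(1) by (simp add: is_interval_convex)
  obtain um where um: "um \<in> interior I" using interval_interior_dense(1)[OF I] by blast
  have umI: "um \<in> I" using um interior_subset by blast
  define K where "K = (\<lambda>t. k t um)"
  have contk: "continuous_on (J \<times> I) (\<lambda>z. k (fst z) (snd z))"
    using curv(1) by (simp add: continuous_on_rect)
  have contK: "continuous_on J K"
    unfolding K_def
    by (rule continuous_on_compose2[OF contk, of _ "\<lambda>t. (t, um)", simplified])
      (use umI in \<open>auto intro!: continuous_intros\<close>)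
  \<comment> \<open>constancy in the interior extends to the end points of both intervals by continuity\<close>
  have kK: "k t u = K t" if tu: "t \<in> J" "u \<in> I" for t u
  proof -
    have "(\<lambda>z. k (fst z) (snd z) - K (fst z)) (t, u) = 0"
    proof (rule continuous_constant_dense[of "J \<times> I" _ "interior J \<times> interior I"])
      show "continuous_on (J \<times> I) (\<lambda>z. k (fst z) (snd z) - K (fst z))"
        by (intro continuous_intros contk continuous_on_compose2[OF contK]) auto
      show "interior J \<times> interior I \<subseteq> J \<times> I" using interior_subset by blast
      show "J \<times> I \<subseteq> closure (interior J \<times> interior I)"
        using interval_interior_dense(2)[OF J] interval_interior_dense(2)[OF I]
        unfolding closure_Times by blast
      show "(t, u) \<in> J \<times> I" using tu by simp
      fix z assume z: "z \<in> interior J \<times> interior I"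
      have "\<exists>c. \<forall>u\<in>interior I. k (fst z) u = c"
      proof (rule has_field_derivative_zero_constant)
        show "convex (interior I)" using cI by (rule convex_interior)
        show "(k (fst z) has_real_derivative 0) (at u within interior I)" if "u \<in> interior I" for u
          by (rule has_field_derivative_at_within[OF curv(2)[OF _ that]]) (use z in auto)
      qed
      then have "k (fst z) (snd z) = k (fst z) um" using mem_Times_iff[THEN iffD1, OF z] um by metis
      then show "k (fst z) (snd z) - K (fst z) = 0" by (simp add: K_def)
    qed
    then show ?thesis by simp
  qed
  have Kpos: "K t > 0" if "t \<in> J" for t
    using assms(8) that umI by (simp add: convex_family_def K_def k_def)
  have ode: "(K has_real_derivative (K t) ^ 3 - K t) (at t)" if "t \<in> interior J" for t
    using curv(3)[OF that um] by (simp add: K_def)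
  obtain c where c: "\<And>t. t \<in> J \<Longrightarrow> 1 - 1 / (K t)\<^sup>2 = c * exp (2 * t)"
    using curvature_time_law[OF J(1,2) contK Kpos ode] by blast
  have "smooth_family J I \<gamma>" using assms(7) by (simp add: csf_solution_def)
  then obtain D where D0: "\<gamma> = D 0 0" and "\<And>m n. continuous_on (J \<times> I) (\<lambda>(t, u). D m n t u)"
    and "\<And>m n t u. t \<in> J \<Longrightarrow> u \<in> I \<Longrightarrow>
      ((\<lambda>t'. D m n t' u) has_vector_derivative D (Suc m) n t u) (at t within J)"
    and D: "\<And>m n t u. t \<in> J \<Longrightarrow> u \<in> I \<Longrightarrow>
      ((\<lambda>u'. D m n t u') has_vector_derivative D m (Suc n) t u) (at u within I)"
    by (rule smooth_familyE) blast
  define E where "E = D 0 1"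
  have d1: "(\<gamma> t has_vector_derivative E t u) (at u within I)" if "t \<in> J" "u \<in> I" for t u
    using D[OF that, of 0 0] by (simp add: D0 E_def)
  have d2: "(E t has_vector_derivative D 0 2 t u) (at u within I)" if "t \<in> J" "u \<in> I" for t u
    using D[OF that, of 0 1] by (simp add: E_def numeral_2_eq_2)
  have up: "\<gamma> t u \<in> hyp_plane" "Im (\<gamma> t u) > 0" if "t \<in> J" "u \<in> I" for t u
    using assms(7) that by (auto simp: csf_solution_def hyp_plane_def)
  have E0: "E t u \<noteq> 0" if "t \<in> J" "u \<in> I" for t u
    using assms(7) that vector_derivative_within[OF at_within_interval_neq_bot[OF I(1) that(2) nI] d1[OF that]]
    by (auto simp: csf_solution_def)
  have locus: thesis if t: "t \<in> J"
    and circle: "\<And>m x0. m \<noteq> 0 \<Longrightarrow> (K t \<ge> 1 \<Longrightarrow> m > 0) \<Longrightarrow>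
      (\<And>u. u \<in> I \<Longrightarrow> (Re (\<gamma> t u) - x0)\<^sup>2 + (Im (\<gamma> t u))\<^sup>2 =
         2 * (K t / m) * Im (\<gamma> t u) + (1 - (K t)\<^sup>2) / m\<^sup>2) \<Longrightarrow> thesis"
    and horizontal: "\<And>h. K t = 1 \<Longrightarrow> h > 0 \<Longrightarrow> (\<And>u. u \<in> I \<Longrightarrow> Im (\<gamma> t u) = h) \<Longrightarrow> thesis"
    and slanted: "\<And>x0 a. K t < 1 \<Longrightarrow> a \<noteq> 0 \<Longrightarrow>
      (\<And>u. u \<in> I \<Longrightarrow> Re (\<gamma> t u) - x0 = a * Im (\<gamma> t u)) \<Longrightarrow> thesis"
    for t thesis
  proof -
    define v C S where "v = (\<lambda>u. cmod (E t u) / Im (\<gamma> t u))"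
      and "C = (\<lambda>u. Re (E t u) / cmod (E t u))" and "S = (\<lambda>u. Im (E t u) / cmod (E t u))"
    have fr: "(C u)\<^sup>2 + (S u)\<^sup>2 = 1"
      "((\<lambda>u. Re (\<gamma> t u)) has_real_derivative v u * Im (\<gamma> t u) * C u) (at u within I)"
      "((\<lambda>u. Im (\<gamma> t u)) has_real_derivative v u * Im (\<gamma> t u) * S u) (at u within I)"
      "(C has_real_derivative - (v u * (K t - C u) * S u)) (at u within I)"
      "(S has_real_derivative v u * (K t - C u) * C u) (at u within I)"
      if u: "u \<in> I" for u
    proof -
      note e = euclidean_frame[OF I(1) u nI d1[OF t] d2[OF t] E0[OF t] up(2)[OF t],
          folded v_def C_def S_def]
      have "geodesic_curvature I (\<gamma> t) u = K t" using kK[OF t u] by (simp add: k_def)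
      then show "(C u)\<^sup>2 + (S u)\<^sup>2 = 1"
        "((\<lambda>u. Re (\<gamma> t u)) has_real_derivative v u * Im (\<gamma> t u) * C u) (at u within I)"
        "((\<lambda>u. Im (\<gamma> t u)) has_real_derivative v u * Im (\<gamma> t u) * S u) (at u within I)"
        "(C has_real_derivative - (v u * (K t - C u) * S u)) (at u within I)"
        "(S has_real_derivative v u * (K t - C u) * C u) (at u within I)"
        using e(4,6,7,8,9) has_real_derivative_Re[OF d1[OF t u]] has_real_derivative_Im[OF d1[OF t u]]
        unfolding v_def C_def S_def by simp_all
    qed
    have neI: "I \<noteq> {}" using umI by blast
    show thesis
      by (rule constant_curvature_locus[OF cI neI Kpos[OF t] up(2)[OF t] fr])
        (assumption | erule circle horizontal slanted; assumption)+
  qed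
  have conn: "connected (\<gamma> t ` I)" if t: "t \<in> J" for t
  proof (rule connected_continuous_image)
    show "continuous_on I (\<gamma> t)"
      unfolding continuous_on_eq_continuous_within
      by (intro ballI has_vector_derivative_continuous[OF d1[OF t]])
    show "connected I" using cI by (rule convex_connected)
  qed
  have sq: "1 / (K t)\<^sup>2 = 1 - c * exp (2 * t)" if "t \<in> J" for t using c[OF that] by simp
  consider "c > 0" | "c = 0" | "c < 0" by linarith
  then show ?thesis
  proof cases
    case 1
    define r where "r = (\<lambda>t. arcosh (1 / sqrt (c * exp (2 * t))))"
    have lt1: "c * exp (2 * t) < 1" if "t \<in> J" for t
    proof -
      have "1 / (K t)\<^sup>2 > 0" using Kpos[OF that] by simp
      then show ?thesis unfolding sq[OF that] by simp
    qed
    have K1: "K t > 1" if "t \<in> J" for t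
    proof -
      have "1 / (K t)\<^sup>2 < 1" unfolding sq[OF that] using 1 by simp
      then have "1\<^sup>2 < (K t)\<^sup>2" using Kpos[OF that] by (simp add: divide_less_eq)
      then show ?thesis using Kpos[OF that] by (intro power2_less_imp_less[of 1 "K t"]) auto
    qed
    have rK: "arcosh (K t / sqrt ((K t)\<^sup>2 - 1)) = r t" if "t \<in> J" for t
    proof -
      have "c * exp (2 * t) = ((K t)\<^sup>2 - 1) / (K t)\<^sup>2"
        using c[OF that] Kpos[OF that] by (simp add: diff_divide_distrib)
      then have "sqrt (c * exp (2 * t)) = sqrt ((K t)\<^sup>2 - 1) / K t"
        using Kpos[OF that] by (simp add: real_sqrt_divide)
      then show ?thesis by (simp add: r_def)
    qed
    have "strict_antimono_on J r"
    proof (rule monotone_onI)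
      fix s t assume st: "s \<in> J" "t \<in> J" "s < t"
      have "c * exp (2 * s) < c * exp (2 * t)" using 1 st(3) by simp
      moreover have "0 < c * exp (2 * s)" using 1 by simp
      ultimately have "1 / sqrt (c * exp (2 * t)) < 1 / sqrt (c * exp (2 * s))"
        by (intro divide_strict_left_mono) auto
      moreover have "1 \<le> 1 / sqrt (c * exp (2 * t))"
        using lt1[OF st(2)] 1 by (simp add: less_imp_le)
      ultimately show "r s > r t" unfolding r_def by (intro arcosh_real_strict_mono)
    qed
    moreover have "\<exists>z. z \<in> hyp_plane \<and> r t > 0 \<and> \<gamma> t ` I \<subseteq> hyp_circle z (r t)" if t: "t \<in> J" for t
    proof (rule locus[OF t])
      fix m x0 assume "K t \<ge> 1 \<Longrightarrow> m > 0" and eq: "\<And>u. u \<in> I \<Longrightarrow>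
        (Re (\<gamma> t u) - x0)\<^sup>2 + (Im (\<gamma> t u))\<^sup>2 = 2 * (K t / m) * Im (\<gamma> t u) + (1 - (K t)\<^sup>2) / m\<^sup>2"
      then have m: "m > 0" using K1[OF t] by simp
      have "\<gamma> t u \<in> hyp_circle (Complex x0 (sqrt ((K t)\<^sup>2 - 1) / m)) (r t)" if "u \<in> I" for u
        using in_hyp_circle[OF K1[OF t] m up(1)[OF t that] eq[OF that]] rK[OF t] by simp
      moreover have "Complex x0 (sqrt ((K t)\<^sup>2 - 1) / m) \<in> hyp_plane"
        using m K1[OF t] by (simp add: hyp_plane_def one_less_power)
      moreover have "r t > 0"
      proof -
        have "1 < 1 / sqrt (c * exp (2 * t))" using lt1[OF t] 1 by simp
        then show ?thesis unfolding r_def by (subst arcosh_real_gt_1_iff) auto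
      qed
      ultimately show ?thesis by blast
    qed (use K1[OF t] in auto)
    then obtain z where "\<forall>t\<in>J. z t \<in> hyp_plane \<and> r t > 0 \<and> \<gamma> t ` I \<subseteq> hyp_circle (z t) (r t)"
      by metis
    ultimately have "shrinking_circles J I \<gamma>" unfolding shrinking_circles_def by blast
    then show ?thesis by blast
  next
    case 2
    have "\<exists>H. hyp_horocycle H \<and> \<gamma> t ` I \<subseteq> H" if t: "t \<in> J" for t
    proof -
      have "1 / (K t)\<^sup>2 = 1" using sq[OF t] 2 by simp
      then have K1: "K t = 1" using Kpos[OF t] by (simp add: power2_eq_1_iff)
      show ?thesis
      proof (rule locus[OF t])
        fix m x0 assume "K t \<ge> 1 \<Longrightarrow> m > 0" and eq: "\<And>u. u \<in> I \<Longrightarrow>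
          (Re (\<gamma> t u) - x0)\<^sup>2 + (Im (\<gamma> t u))\<^sup>2 = 2 * (K t / m) * Im (\<gamma> t u) + (1 - (K t)\<^sup>2) / m\<^sup>2"
        then have m: "m > 0" using K1 by simp
        have "cmod (\<gamma> t u - Complex x0 (1 / m)) = 1 / m" if "u \<in> I" for u
          by (rule in_horocycle[OF m up(1)[OF t that]]) (use eq[OF that] K1 in simp)
        then have "\<gamma> t ` I \<subseteq> {w \<in> hyp_plane. cmod (w - Complex x0 (1 / m)) = 1 / m}"
          using up(1)[OF t] by blast
        moreover have "hyp_horocycle {w \<in> hyp_plane. cmod (w - Complex x0 (1 / m)) = 1 / m}"
          unfolding hyp_horocycle_def using m by (metis zero_less_divide_1_iff)
        ultimately show ?thesis by blast
      next
        fix h assume "h > 0" "\<And>u. u \<in> I \<Longrightarrow> Im (\<gamma> t u) = h"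
        then have "hyp_horocycle {w \<in> hyp_plane. Im w = h}" "\<gamma> t ` I \<subseteq> {w \<in> hyp_plane. Im w = h}"
          unfolding hyp_horocycle_def using up(1)[OF t] by blast+
        then show ?thesis by blast
      qed (use K1 in auto)
    qed
    then have "horocycle_family J I \<gamma>" by (simp add: horocycle_family_def)
    then show ?thesis by blast
  next
    case 3
    have "\<exists>E. hyp_equidistant_line E \<and> \<gamma> t ` I \<subseteq> E" if t: "t \<in> J" for t
    proof -
      have "1 / (K t)\<^sup>2 > 1" unfolding sq[OF t] using 3 by (simp add: mult_neg_pos)
      then have k2: "(K t)\<^sup>2 < 1" using Kpos[OF t] by (simp add: less_divide_eq)
      then have K1: "K t < 1" using power2_less_imp_less[of "K t" 1] by simp
      have ne: "\<gamma> t ` I \<noteq> {}" and hp: "\<gamma> t ` I \<subseteq> hyp_plane" using umI up(1)[OF t] by blast+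
      show ?thesis
      proof (rule locus[OF t])
        fix m x0 assume m: "m \<noteq> 0" and eq: "\<And>u. u \<in> I \<Longrightarrow>
          (Re (\<gamma> t u) - x0)\<^sup>2 + (Im (\<gamma> t u))\<^sup>2 = 2 * (K t / m) * Im (\<gamma> t u) + (1 - (K t)\<^sup>2) / m\<^sup>2"
        \<comment> \<open>the power of \<open>x0\<close> with respect to the Euclidean circle is \<open>- R\<^sup>2\<close>, so the circle meets the
           boundary line where the geodesic of radius \<open>R\<close> does\<close>
        define R where "R = sqrt (1 - (K t)\<^sup>2) / \<bar>m\<bar>"
        have R: "R > 0" "R\<^sup>2 = (1 - (K t)\<^sup>2) / m\<^sup>2"
          using k2 m by (auto simp: R_def power_divide)
        show ?thesis
        proof (rule equidistant_from_half_circle[OF conn[OF t] ne hp _ R(1)])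
          show "K t / (m * R) \<noteq> 0" using m R(1) Kpos[OF t] by simp
          fix w assume "w \<in> \<gamma> t ` I"
          then obtain u where u: "u \<in> I" "w = \<gamma> t u" by blast
          have "(cmod (w - complex_of_real x0))\<^sup>2 = (Re w - x0)\<^sup>2 + (Im w)\<^sup>2"
            by (simp add: cmod_power2)
          then have "(cmod (w - complex_of_real x0))\<^sup>2 - R\<^sup>2 = 2 * (K t / m) * Im w"
            unfolding R(2) using eq[OF u(1)] u(2) by simp
          then show "(cmod (w - complex_of_real x0))\<^sup>2 - R\<^sup>2 = 2 * (K t / (m * R)) * R * Im w"
            using R(1) by simp
        qed
      next
        fix x0 a assume "a \<noteq> 0" "\<And>u. u \<in> I \<Longrightarrow> Re (\<gamma> t u) - x0 = a * Im (\<gamma> t u)"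
        then show ?thesis
          by (intro equidistant_from_vertical[OF conn[OF t] ne hp, of a x0]) auto
      qed (use K1 in auto)
    qed
    then have "equidistant_family J I \<gamma>" by (simp add: equidistant_family_def)
    then show ?thesis by blast
  qed
qed

end
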